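(* Let $\mathcal G$ be a Hilbert space, let $\mathcal D\subset\mathbb C^+$ be a simply connected open set and let $\tau:\mathcal D\cup\mathcal D^*\rightarrow\mathcal L(\mathcal G)$ be a piecewise meromorphic operator function which admits a minimal representation (in the sense of the context) on $\mathcal O\cup\mathcal O^*$ by a selfadjoint relation $A_0$ in a Krein space $\mathcal H$ and a mapping $\gamma\in\mathcal L(\mathcal G,\mathcal H)$. Then there exist a Krein space $\mathcal K$, a closed symmetric operator $S$ in $\mathcal K$ and a generalized boundary triple $\{\mathcal G,\Gamma_0,\Gamma_1\}$ for $S^+$ such that the corresponding Weyl function coincides with $\tau$ on $\mathcal O\cup\mathcal O^*$.
   Context: **Relations in Krein spaces.** All spaces are complex. Let $(\mathcal H,[\cdot,\cdot])$ be a Krein space. A linear relation in $\mathcal H$ is a linear subspace of $\mathcal H\times\mathcal H$; its elements are written $\hat f=\{f,f'\}$, and linear operators are identified with their graphs. $\mathcal L(\mathcal G,\mathcal H)$ denotes the bounded everywhere defined operators from $\mathcal G$ to $\mathcal H$, $\mathcal L(\mathcal G)=\mathcal L(\mathcal G,\mathcal G)$, and $^+$ denotes the adjoint of a bounded operator with respect to the given (Krein or Hilbert space) inner products. On $\mathcal H\times\mathcal H$ put $[[\hat f,\hat g]]_{\mathcal H^2}:=i([f,g']-[f',g])$ (and similarly $[[\cdot,\cdot]]_{\mathcal G^2}$ for a Hilbert space $\mathcal G$). The adjoint of a relation $A$ is $A^+:=\{\hat f\in\mathcal H^2:[[\hat f,\hat g]]_{\mathcal H^2}=0\text{ for all }\hat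 g\in A\}$; $A$ is symmetric if $A\subset A^+$ and selfadjoint if $A=A^+$. For a closed relation $A$, $(A-\lambda)^{-1}=\{\{f'-\lambda f,f\}:\{f,f'\}\in A\}$ and $\rho(A)=\{\lambda\in\mathbb C:(A-\lambda)^{-1}\in\mathcal L(\mathcal H)\}$. **Generalized boundary triples.** Let $A$ be a closed symmetric relation in $\mathcal H$ and let $T$ be a linear relation in $\mathcal H$ with $\overline T=A^+$. A triple $\{\mathcal G,\Gamma_0,\Gamma_1\}$ is a generalized boundary triple for $A^+$ if $\mathcal G$ is a Hilbert space and $\Gamma=(\Gamma_0,\Gamma_1)^\top:T\to\mathcal G\times\mathcal G$ is a linear mapping such that $[[\hat f,\hat g]]_{\mathcal H^2}=[[\Gamma\hat f,\Gamma\hat g]]_{\mathcal G^2}$ for all $\hat f,\hat g\in T$, $\mathrm{ran}\,\Gamma_0=\mathcal G$, and $\ker\Gamma_0$ is a selfadjoint relation in $\mathcal H$. **Weyl function.** If $\rho(\ker\Gamma_0)\ne\emptyset$, the Weyl function of the triple is $M(\lambda)=\Gamma_1(\Gamma_0\upharpoonright\widehat{\mathcal N}_{\lambda,T})^{-1}\in\mathcal L(\mathcal G)$, $\lambda\in\rho(\ker\Gamma_0)$, where $\widehat{\mathcal N}_{\lambda,T}=\{\{f_\lambda,\lambda f_\lambda\}:f_\lambda\in\ker(T-\lambda)\}$. That $M$ coincides with $\tau$ on a set $\mathcal V$ means $\mathcal V\subset\rho(\ker\Gamma_0)$ and $M(\lambda)=\tau(\lambda)$ for $\lambda\in\mathcal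 V$. **Minimal representation.** For $\mathcal D\subset\mathbb C$, $\mathcal D^*=\{\lambda:\bar\lambda\in\mathcal D\}$. A minimal representation of $\tau$ consists of a Krein space $\mathcal H$, a selfadjoint relation $A_0$ in $\mathcal H$ with $\rho(A_0)\neq\emptyset$, a mapping $\gamma\in\mathcal L(\mathcal G,\mathcal H)$, a (nonempty) open subset $\mathcal O$ of $\rho(A_0)\cap\mathcal D$ and a fixed $\lambda_0\in\mathcal O\cup\mathcal O^*$ such that for all $\lambda\in\mathcal O\cup\mathcal O^*$ $$\tau(\lambda)=\mathrm{Re}\,\tau(\lambda_0)+\gamma^+\bigl((\lambda-\mathrm{Re}\,\lambda_0)+(\lambda-\lambda_0)(\lambda-\bar\lambda_0)(A_0-\lambda)^{-1}\bigr)\gamma,$$ and $\mathcal H$ is the closed linear span of $\{(I+(\lambda-\lambda_0)(A_0-\lambda)^{-1})\gamma x:\lambda\in\mathcal O\cup\mathcal O^*,\,x\in\mathcal G\}$. *)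

theory Defs
  imports "HOL-Analysis.Analysis"
begin

text \<open>
  Complex inner product spaces, in general indefinite. The vectors form the whole type; scalar
  multiplication and inner product are data, so that one can quantify over spaces. Inner
  products are linear in the first argument.
\<close>

record 'a ip_space =
  scl :: "complex \<Rightarrow> 'a \<Rightarrow> 'a"
  ip :: "'a \<Rightarrow> 'a \<Rightarrow> complex"

definition hermitian_space :: "'a::ab_group_add ip_space \<Rightarrow> bool" where
  "hermitian_space X \<longleftrightarrow>
     vector_space (scl X) \<and>
     (\<forall>y. Vector_Spaces.linear (scl X) (*) (\<lambda>x. ip X x y)) \<and>
     (\<forall>x y. ip X y x = cnj (ip X x y))"

text \<open>
  The restriction of a hermitian form to a subspace \<open>V\<close> is a Hilbert space inner product. The
  absolute value has no effect on \<open>V\<close>; \<^locale>\<open>Metric_space\<close> requires a distance that is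
  nonnegative off \<open>V\<close> as well.
\<close>

definition hilbert_on :: "('a::ab_group_add \<Rightarrow> 'a \<Rightarrow> complex) \<Rightarrow> 'a set \<Rightarrow> bool" where
  "hilbert_on b V \<longleftrightarrow>
     (\<forall>x\<in>V. x \<noteq> 0 \<longrightarrow> 0 < Re (b x x)) \<and>
     Metric_space.mcomplete V (\<lambda>x y. sqrt \<bar>Re (b (x - y) (x - y))\<bar>)"

definition hilbert_space :: "'a::ab_group_add ip_space \<Rightarrow> bool" where
  "hilbert_space X \<longleftrightarrow> hermitian_space X \<and> hilbert_on (ip X) UNIV"

definition fundamental_decomposition ::
    "'a::ab_group_add ip_space \<Rightarrow> 'a set \<Rightarrow> 'a set \<Rightarrow> bool" where
  "fundamental_decomposition X P N \<longleftrightarrow>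
     module.subspace (scl X) P \<and> module.subspace (scl X) N \<and>
     (\<forall>p\<in>P. \<forall>n\<in>N. ip X p n = 0) \<and>
     P \<inter> N = {0} \<and> (\<forall>x. \<exists>p\<in>P. \<exists>n\<in>N. x = p + n) \<and>
     hilbert_on (ip X) P \<and> hilbert_on (\<lambda>x y. - ip X x y) N"

definition krein_space :: "'a::ab_group_add ip_space \<Rightarrow> bool" where
  "krein_space X \<longleftrightarrow> hermitian_space X \<and> (\<exists>P N. fundamental_decomposition X P N)"

text \<open>
  Topological notions in a Krein space refer to the Hilbert space norm
  \<open>\<parallel>p + n\<parallel>\<^sup>2 = [p,p] - [n,n]\<close> of a fundamental decomposition. The norms of any two fundamental
  decompositions are equivalent, so boundedness, closedness and closures below do not depend on
  which one is picked. A Hilbert space has only the decomposition into itself and \<open>{0}\<close>;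
  there this is the usual norm.
\<close>

definition kp_norm :: "'a::ab_group_add ip_space \<Rightarrow> 'a \<Rightarrow> real" where
  "kp_norm X x =
     (let (P, N) = (SOME (P, N). fundamental_decomposition X P N)
      in THE r. \<exists>p\<in>P. \<exists>n\<in>N. x = p + n \<and> r = sqrt (Re (ip X p p) - Re (ip X n n)))"

definition kp_topology :: "'a::ab_group_add ip_space \<Rightarrow> 'a topology" where
  "kp_topology X = Metric_space.mtopology UNIV (\<lambda>x y. kp_norm X (x - y))"

definition bounded_ops ::
    "'a::ab_group_add ip_space \<Rightarrow> 'b::ab_group_add ip_space \<Rightarrow> ('a \<Rightarrow> 'b) set" where
  "bounded_ops X Y =
     {B. Vector_Spaces.linear (scl X) (scl Y) B \<and> (\<exists>c. \<forall>x. kp_norm Y (B x) \<le> c * kp_norm X x)}"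

definition op_adjoint ::
    "'a::ab_group_add ip_space \<Rightarrow> 'b::ab_group_add ip_space \<Rightarrow> ('a \<Rightarrow> 'b) \<Rightarrow> 'b \<Rightarrow> 'a" where
  "op_adjoint X Y B = (THE C. \<forall>x y. ip Y (B x) y = ip X x (C y))"

definition op_real_part :: "'a::ab_group_add ip_space \<Rightarrow> ('a \<Rightarrow> 'a) \<Rightarrow> 'a \<Rightarrow> 'a" where
  "op_real_part X B x = scl X (1/2) (B x + op_adjoint X X B x)"


text \<open>Operator functions; holomorphy is with respect to the operator norm.\<close>

definition op_has_derivative ::
    "'a::ab_group_add ip_space \<Rightarrow> (complex \<Rightarrow> 'a \<Rightarrow> 'a) \<Rightarrow> ('a \<Rightarrow> 'a) \<Rightarrow> complex \<Rightarrow> bool" where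
  "op_has_derivative X F B z \<longleftrightarrow>
     (\<forall>e>0. \<exists>d>0. \<forall>w. dist w z < d \<longrightarrow>
        (\<forall>x. kp_norm X (F w x - F z x - scl X (w - z) (B x)) \<le> e * dist w z * kp_norm X x))"

text \<open>Used for open sets only.\<close>

definition op_holomorphic_on ::
    "'a::ab_group_add ip_space \<Rightarrow> (complex \<Rightarrow> 'a \<Rightarrow> 'a) \<Rightarrow> complex set \<Rightarrow> bool" where
  "op_holomorphic_on X F U \<longleftrightarrow>
     (\<forall>z\<in>U. F z \<in> bounded_ops X X \<and> (\<exists>B\<in>bounded_ops X X. op_has_derivative X F B z))"

text \<open>
  Every point is a point of holomorphy or an isolated singularity that is at most a pole.
  The value at a pole is arbitrary.
\<close>

definition op_meromorphic_on ::
    "'a::ab_group_add ip_space \<Rightarrow> (complex \<Rightarrow> 'a \<Rightarrow> 'a) \<Rightarrow> complex set \<Rightarrow> bool" where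
  "op_meromorphic_on X F U \<longleftrightarrow>
     (\<forall>z\<in>U. \<exists>m r E. r > 0 \<and> op_holomorphic_on X E (ball z r) \<and>
        (\<forall>w\<in>ball z r - {z}. \<forall>x. F w x = scl X (inverse ((w - z) ^ m)) (E w x)))"


text \<open>Linear relations.\<close>

definition scl2 :: "'a ip_space \<Rightarrow> complex \<Rightarrow> 'a \<times> 'a \<Rightarrow> 'a \<times> 'a" where
  "scl2 X c = (\<lambda>(f, f'). (scl X c f, scl X c f'))"

definition linear_relation :: "'a::ab_group_add ip_space \<Rightarrow> 'a rel \<Rightarrow> bool" where
  "linear_relation X A \<longleftrightarrow> module.subspace (scl2 X) A"

definition topology2 :: "'a::ab_group_add ip_space \<Rightarrow> ('a \<times> 'a) topology" where
  "topology2 X = prod_topology (kp_topology X) (kp_topology X)"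

definition ip2 :: "'a ip_space \<Rightarrow> 'a \<times> 'a \<Rightarrow> 'a \<times> 'a \<Rightarrow> complex" where
  "ip2 X = (\<lambda>(f, f') (g, g'). \<i> * (ip X f g' - ip X f' g))"

definition rel_adjoint :: "'a ip_space \<Rightarrow> 'a rel \<Rightarrow> 'a rel" where
  "rel_adjoint X A = {f. \<forall>g\<in>A. ip2 X f g = 0}"

definition symmetric_relation :: "'a::ab_group_add ip_space \<Rightarrow> 'a rel \<Rightarrow> bool" where
  "symmetric_relation X A \<longleftrightarrow> linear_relation X A \<and> A \<subseteq> rel_adjoint X A"

definition selfadjoint_relation :: "'a::ab_group_add ip_space \<Rightarrow> 'a rel \<Rightarrow> bool" where
  "selfadjoint_relation X A \<longleftrightarrow> linear_relation X A \<and> A = rel_adjoint X A"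

definition resolvent_relation :: "'a::ab_group_add ip_space \<Rightarrow> 'a rel \<Rightarrow> complex \<Rightarrow> 'a rel" where
  "resolvent_relation X A z = {(f' - scl X z f, f) | f f'. (f, f') \<in> A}"

definition resolvent_set :: "'a::ab_group_add ip_space \<Rightarrow> 'a rel \<Rightarrow> complex set" where
  "resolvent_set X A =
     {z. \<exists>R\<in>bounded_ops X X. resolvent_relation X A z = {(x, R x) | x. True}}"

definition resolvent_op :: "'a::ab_group_add ip_space \<Rightarrow> 'a rel \<Rightarrow> complex \<Rightarrow> 'a \<Rightarrow> 'a" where
  "resolvent_op X A z x = (THE y. (x, y) \<in> resolvent_relation X A z)"


text \<open>Boundary mappings are only relevant on their domain \<open>T\<close>; \<open>A\<close> is the closed symmetric relation.\<close>

definition boundary_kernel :: "'k rel \<Rightarrow> ('k \<times> 'k \<Rightarrow> 'g::zero) \<Rightarrow> 'k rel" where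
  "boundary_kernel T \<Gamma> = {f \<in> T. \<Gamma> f = 0}"

definition linear_on_relation ::
    "'k::ab_group_add ip_space \<Rightarrow> 'g::ab_group_add ip_space \<Rightarrow> 'k rel \<Rightarrow> ('k \<times> 'k \<Rightarrow> 'g) \<Rightarrow> bool"
where
  "linear_on_relation K G T \<Gamma> \<longleftrightarrow>
     (\<forall>f\<in>T. \<forall>g\<in>T. \<Gamma> (f + g) = \<Gamma> f + \<Gamma> g) \<and>
     (\<forall>c. \<forall>f\<in>T. \<Gamma> (scl2 K c f) = scl G c (\<Gamma> f))"

definition generalized_boundary_triple ::
    "'k::ab_group_add ip_space \<Rightarrow> 'k rel \<Rightarrow> 'k rel \<Rightarrow> 'g::ab_group_add ip_space \<Rightarrow>
     ('k \<times> 'k \<Rightarrow> 'g) \<Rightarrow> ('k \<times> 'k \<Rightarrow> 'g) \<Rightarrow> bool" where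
  "generalized_boundary_triple K A T G \<Gamma>\<^sub>0 \<Gamma>\<^sub>1 \<longleftrightarrow>
     linear_relation K T \<and>
     topology2 K closure_of T = rel_adjoint K A \<and>
     hilbert_space G \<and>
     linear_on_relation K G T \<Gamma>\<^sub>0 \<and> linear_on_relation K G T \<Gamma>\<^sub>1 \<and>
     (\<forall>f\<in>T. \<forall>g\<in>T. ip2 K f g = ip2 G (\<Gamma>\<^sub>0 f, \<Gamma>\<^sub>1 f) (\<Gamma>\<^sub>0 g, \<Gamma>\<^sub>1 g)) \<and>
     \<Gamma>\<^sub>0 ` T = UNIV \<and>
     selfadjoint_relation K (boundary_kernel T \<Gamma>\<^sub>0)"

definition defect_relation :: "'k ip_space \<Rightarrow> 'k rel \<Rightarrow> complex \<Rightarrow> 'k rel" where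
  "defect_relation K T z = {(f, scl K z f) | f. (f, scl K z f) \<in> T}"

definition weyl_function ::
    "'k ip_space \<Rightarrow> 'k rel \<Rightarrow> ('k \<times> 'k \<Rightarrow> 'g) \<Rightarrow> ('k \<times> 'k \<Rightarrow> 'g) \<Rightarrow> complex \<Rightarrow> 'g \<Rightarrow> 'g" where
  "weyl_function K T \<Gamma>\<^sub>0 \<Gamma>\<^sub>1 z = \<Gamma>\<^sub>1 \<circ> inv_into (defect_relation K T z) \<Gamma>\<^sub>0"

definition weyl_function_coincides ::
    "'k::ab_group_add ip_space \<Rightarrow> 'k rel \<Rightarrow> ('k \<times> 'k \<Rightarrow> 'g::zero) \<Rightarrow> ('k \<times> 'k \<Rightarrow> 'g) \<Rightarrow>
     (complex \<Rightarrow> 'g \<Rightarrow> 'g) \<Rightarrow> complex set \<Rightarrow> bool" where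
  "weyl_function_coincides K T \<Gamma>\<^sub>0 \<Gamma>\<^sub>1 \<tau> V \<longleftrightarrow>
     V \<subseteq> resolvent_set K (boundary_kernel T \<Gamma>\<^sub>0) \<and>
     (\<forall>z\<in>V. weyl_function K T \<Gamma>\<^sub>0 \<Gamma>\<^sub>1 z = \<tau> z)"


text \<open>For \<open>D \<subseteq> \<complex>\<close> the reflected set \<open>D\<^sup>*\<close> is the preimage \<^term>\<open>cnj -` D\<close>.\<close>

definition minimal_representation ::
    "'g::ab_group_add ip_space \<Rightarrow> complex set \<Rightarrow> (complex \<Rightarrow> 'g \<Rightarrow> 'g) \<Rightarrow>
     'h::ab_group_add ip_space \<Rightarrow> 'h rel \<Rightarrow> ('g \<Rightarrow> 'h) \<Rightarrow> complex set \<Rightarrow> complex \<Rightarrow> bool" where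
  "minimal_representation G D \<tau> H A\<^sub>0 \<gamma> \<O> z\<^sub>0 \<longleftrightarrow>
     krein_space H \<and>
     selfadjoint_relation H A\<^sub>0 \<and> resolvent_set H A\<^sub>0 \<noteq> {} \<and>
     \<gamma> \<in> bounded_ops G H \<and>
     open \<O> \<and> \<O> \<noteq> {} \<and> \<O> \<subseteq> resolvent_set H A\<^sub>0 \<inter> D \<and>
     z\<^sub>0 \<in> \<O> \<union> cnj -` \<O> \<and>
     (\<forall>z\<in>\<O> \<union> cnj -` \<O>. \<forall>x.
        \<tau> z x = op_real_part G (\<tau> z\<^sub>0) x +
          op_adjoint G H \<gamma>
            (scl H (z - complex_of_real (Re z\<^sub>0)) (\<gamma> x) +
             scl H ((z - z\<^sub>0) * (z - cnj z\<^sub>0)) (resolvent_op H A\<^sub>0 z (\<gamma> x)))) \<and>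
     kp_topology H closure_of
       module.span (scl H)
         {\<gamma> x + scl H (z - z\<^sub>0) (resolvent_op H A\<^sub>0 z (\<gamma> x)) | z x. z \<in> \<O> \<union> cnj -` \<O>} = UNIV"

end

theory Submission
  imports Defs
begin

text \<open>
  The representation of \<open>\<tau>\<close> already has the form of a Weyl function: if \<open>\<gamma>\<close> is injective with closed
  range, then \<open>A\<^sub>0\<close> together with the vectors \<open>(\<gamma> x, z\<^sub>0 \<gamma> x)\<close> spans a relation \<open>T\<close>, the vector \<open>x\<close> is the first
  boundary value of an element of \<open>T\<close>, and Green's identity together with the value \<open>\<tau> z\<^sub>0\<close> dictates
  the second one. In general \<open>\<gamma>\<close> may have a kernel, as for a constant function \<open>\<tau>\<close>, while the operator that inverts \<open>\<Gamma>\<^sub>0\<close> on a defect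
  subspace is always injective. The remedy is to enlarge \<open>H\<close> to \<open>K = H \<oplus> (G \<oplus> -G)\<close>, where \<open>-G\<close> carries the
  negative inner product, to extend \<open>A\<^sub>0\<close> by the zero operator to a selfadjoint relation \<open>A\<close>, and to
  replace \<open>\<gamma>\<close> by \<open>g x = (\<gamma> x, x, x)\<close>. The vectors \<open>(x, x)\<close> span a neutral subspace that is invariant
  under the resolvents of the zero operator, so the represented function stays the same.

  The adjoint of \<open>g\<close> is \<open>g' (h, a, b) = \<gamma>\<^sup>+ h + a - b\<close>, and a vector orthogonal to its kernel is visibly of the
  form \<open>g x\<close>. For this reason \<open>T\<close> is the adjoint of \<open>S = T\<^sup>+\<close> by direct computation
  (\<open>T_eq_rel_adjoint_S\<close>), and \<open>T\<close> itself is closed. The relation \<open>S\<close> consists of the pairs \<open>(f, f')\<close> of \<open>A\<close> with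
  \<open>g' (f' - cnj z\<^sub>0 f) = 0\<close>; it is an operator because by minimality no nonzero vector of the multivalued part
  of \<open>A\<^sub>0\<close> is annihilated by \<open>\<gamma>\<^sup>+\<close> (\<open>minimal_multivalued_part\<close>). The computation of the Weyl function
  (\<open>gamma_map.weyl_function\<close>) reproduces the representation of \<open>\<tau>\<close>.

  The analytic ingredients concern a single Krein space: the Riesz representation theorem, which
  yields the adjoints in the representation, the fact that the spectrum of a selfadjoint relation is
  symmetric with respect to the real axis, and the Hellinger-Toeplitz theorem
  (\<open>krein.bounded_if_adjoint\<close>), which shows that the resolvents of the orthogonal sum are bounded in the norm of
  an arbitrary fundamental decomposition.
\<close>

section \<open>Hermitian and positive definite forms\<close>

locale hermitian_form = vector_space s
  for s :: "complex \<Rightarrow> 'a::ab_group_add \<Rightarrow> 'a" +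
  fixes b :: "'a \<Rightarrow> 'a \<Rightarrow> complex"
  assumes add_left: "b (x + y) z = b x z + b y z"
    and scale_left: "b (s c x) z = c * b x z"
    and commute: "b y x = cnj (b x y)"
begin

lemma add_right: "b x (y + z) = b x y + b x z"
  by (metis add_left commute complex_cnj_add)

lemma scale_right: "b x (s c y) = cnj c * b x y"
  by (metis scale_left commute complex_cnj_mult)

lemma zero_left [simp]: "b 0 x = 0"
  using add_left[of 0 0 x] by simp

lemma zero_right [simp]: "b x 0 = 0"
  using add_right[of x 0 0] by simp

lemma minus_left: "b (- x) y = - b x y"
  using add_left[of "- x" x y] by (simp add: eq_neg_iff_add_eq_0)

lemma minus_right: "b x (- y) = - b x y"
  using add_right[of x "- y" y] by (simp add: eq_neg_iff_add_eq_0)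

lemma diff_left: "b (x - y) z = b x z - b y z"
  by (metis add_left minus_left add.commute uminus_add_conv_diff)

lemma diff_right: "b x (y - z) = b x y - b x z"
  by (metis add_right minus_right add.commute uminus_add_conv_diff)

lemmas form_simps = add_left add_right scale_left scale_right minus_left minus_right diff_left diff_right

lemma self_real: "b x x = complex_of_real (Re (b x x))"
  using commute[of x x] by (simp add: complex_eq_iff)

end

locale positive_form = hermitian_form +
  fixes V
  assumes subspace: "subspace V"
    and positive: "\<And>x. x \<in> V \<Longrightarrow> x \<noteq> 0 \<Longrightarrow> 0 < Re (b x x)"
begin

text \<open>
  The absolute value matches the distance in \<^const>\<open>hilbert_on\<close>, which is total even though the form is
  positive on \<open>V\<close> only.
\<close>

definition nrm :: "'a \<Rightarrow> real" where
  "nrm x = sqrt \<bar>Re (b x x)\<bar>"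

lemma nonneg: "x \<in> V \<Longrightarrow> 0 \<le> Re (b x x)"
  using positive[of x] by (cases "x = 0") auto

lemma nrm_nonneg [simp]: "0 \<le> nrm x"
  by (simp add: nrm_def)

lemma nrm_sq: "x \<in> V \<Longrightarrow> (nrm x)\<^sup>2 = Re (b x x)"
  by (simp add: nrm_def nonneg)

lemma nrm_eq_0: "x \<in> V \<Longrightarrow> nrm x = 0 \<longleftrightarrow> x = 0"
  using positive[of x] by (cases "x = 0") (auto simp: nrm_def)

lemma nrm_scale: "nrm (s c x) = cmod c * nrm x"
proof -
  have "b (s c x) (s c x) = of_real ((cmod c)\<^sup>2) * b x x"
    unfolding form_simps complex_norm_square by (simp add: mult.assoc)
  hence "Re (b (s c x) (s c x)) = (cmod c)\<^sup>2 * Re (b x x)"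
    by simp
  thus ?thesis
    by (simp add: nrm_def abs_mult real_sqrt_mult)
qed

lemma nrm_minus [simp]: "nrm (- x) = nrm x"
  by (simp add: nrm_def form_simps)

lemma Cauchy_Schwarz:
  assumes "x \<in> V" "y \<in> V"
  shows "cmod (b x y) \<le> nrm x * nrm y"
proof (cases "y = 0")
  case False
  define r where "r = Re (b y y)"
  have r: "r > 0" using positive[OF assms(2) False] by (simp add: r_def)
  \<comment> \<open>\<open>s c y\<close> is the orthogonal projection of \<open>x\<close> to the line of \<open>y\<close>.\<close>
  define c where "c = b x y / of_real r"
  have "x - s c y \<in> V"
    using assms by (intro subspace_diff subspace_scale subspace)
  hence "0 \<le> Re (b (x - s c y) (x - s c y))"
    by (rule nonneg)
  also have "b (x - s c y) (x - s c y)
      = b x x - cnj c * b x y - c * cnj (b x y) + c * cnj c * of_real r"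
    using self_real[of y] unfolding form_simps r_def
    by (simp add: commute[of y x] algebra_simps)
  also have "cnj c * b x y = of_real ((cmod (b x y))\<^sup>2 / r)"
    unfolding c_def using complex_norm_square[of "b x y"] by (simp add: mult.commute)
  also have "c * cnj (b x y) = of_real ((cmod (b x y))\<^sup>2 / r)"
    unfolding c_def using complex_norm_square[of "b x y"] by simp
  also have "c * cnj c * of_real r = of_real ((cmod (b x y))\<^sup>2 / r)"
    unfolding c_def using complex_norm_square[of "b x y"] r by simp
  finally have "(cmod (b x y))\<^sup>2 / r \<le> Re (b x x)"
    by simp
  hence "(cmod (b x y))\<^sup>2 \<le> Re (b x x) * r"
    using r by (simp add: field_simps)
  also have "\<dots> = (nrm x * nrm y)\<^sup>2"
    using assms by (simp add: power_mult_distrib nrm_sq r_def)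
  finally show ?thesis
    by (rule power2_le_imp_le) simp
qed simp

lemma nrm_triangle:
  assumes "x \<in> V" "y \<in> V"
  shows "nrm (x + y) \<le> nrm x + nrm y"
proof -
  have "(nrm (x + y))\<^sup>2 = Re (b x x) + Re (b y y) + 2 * Re (b x y)"
    using assms by (simp add: nrm_sq subspace_add[OF subspace] form_simps commute[of y x])
  also have "\<dots> \<le> Re (b x x) + Re (b y y) + 2 * (nrm x * nrm y)"
    using Cauchy_Schwarz[OF assms] complex_Re_le_cmod[of "b x y"] by simp
  also have "\<dots> = (nrm x + nrm y)\<^sup>2"
    using assms by (simp add: power2_sum nrm_sq)
  finally show ?thesis
    by (rule power2_le_imp_le) simp
qed

lemma metric: "Metric_space V (\<lambda>x y. nrm (x - y))"
proof
  fix x y z assume V: "x \<in> V" "y \<in> V" "z \<in> V"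
  show "nrm (x - z) \<le> nrm (x - y) + nrm (y - z)"
    using nrm_triangle[of "x - y" "y - z"] V by (simp add: subspace_diff[OF subspace])
next
  fix x y show "nrm (x - y) = nrm (y - x)"
    using nrm_minus[of "x - y"] by simp
qed (auto simp: nrm_eq_0 subspace_diff[OF subspace])

lemma limitin_iff:
  "limitin (Metric_space.mtopology V (\<lambda>x y. nrm (x - y))) \<sigma> l sequentially \<longleftrightarrow>
    l \<in> V \<and> (\<forall>\<^sub>F n in sequentially. \<sigma> n \<in> V) \<and> (\<lambda>n. nrm (\<sigma> n - l)) \<longlonglongrightarrow> 0"
proof -
  interpret Metric_space V "\<lambda>x y. nrm (x - y)" by (rule metric)
  show ?thesis
    unfolding limitin_metric tendsto_iff
    by (auto simp: eventually_conj_iff intro: zero_less_one)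
qed

text \<open>
  Completeness as a statement about sequences. It is used to pass completeness from subspaces
  and summands to the whole space.
\<close>

lemma hilbert_on_iff:
  "hilbert_on b V \<longleftrightarrow>
    (\<forall>\<sigma>. (\<forall>n. \<sigma> n \<in> V) \<longrightarrow> (\<forall>e>0. \<exists>N. \<forall>m\<ge>N. \<forall>n\<ge>N. nrm (\<sigma> m - \<sigma> n) < e) \<longrightarrow>
      (\<exists>l\<in>V. (\<lambda>n. nrm (\<sigma> n - l)) \<longlonglongrightarrow> 0))"
proof -
  interpret Metric_space V "\<lambda>x y. nrm (x - y)" by (rule metric)
  have "hilbert_on b V \<longleftrightarrow> mcomplete"
    unfolding hilbert_on_def using positive by (auto simp: nrm_def)
  also have "\<dots> \<longleftrightarrow> (\<forall>\<sigma>. (\<forall>n. \<sigma> n \<in> V) \<longrightarrow> (\<forall>e>0. \<exists>N. \<forall>m\<ge>N. \<forall>n\<ge>N. nrm (\<sigma> m - \<sigma> n) < e) \<longrightarrow>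
      (\<exists>l\<in>V. (\<lambda>n. nrm (\<sigma> n - l)) \<longlonglongrightarrow> 0))"
    unfolding mcomplete_def MCauchy_def image_subset_iff limitin_iff
    apply (intro all_cong1)
    subgoal for \<sigma> by (cases "\<forall>n. \<sigma> n \<in> V") auto
    done
  finally show ?thesis .
qed

end

section \<open>The Hilbert space structure of a Krein space\<close>

lemma hermitian_form_ip:
  assumes "hermitian_space X"
  shows "hermitian_form (scl X) (ip X)"
proof -
  have X: "vector_space (scl X)" "Vector_Spaces.linear (scl X) (*) (\<lambda>x. ip X x z)"
    "ip X y x = cnj (ip X x y)" for x y z
    using assms unfolding hermitian_space_def by blast+
  interpret vector_space "scl X" by (rule X)
  show ?thesis
  proof
    fix x y z c
    interpret Vector_Spaces.linear "scl X" "(*)" "\<lambda>x. ip X x z" by (rule X)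
    show "ip X (x + y) z = ip X x z + ip X y z" "ip X (scl X c x) z = c * ip X x z"
      by (rule add, rule scale)
  qed (rule X)
qed

lemma hermitian_spaceI:
  assumes "hermitian_form (scl X) (ip X)"
  shows "hermitian_space X"
proof -
  interpret hermitian_form "scl X" "ip X" by (rule assms)
  have "Vector_Spaces.linear (scl X) (*) (\<lambda>x. ip X x y)" for y
    by unfold_locales (simp_all add: form_simps algebra_simps)
  thus ?thesis
    unfolding hermitian_space_def by (intro conjI allI vector_space_axioms commute)
qed

lemma (in hermitian_form) uminus_form: "hermitian_form s (\<lambda>x y. - b x y)"
proof
  fix x y show "- b y x = cnj (- b x y)" using commute[of y x] by simp
qed (simp_all add: form_simps)

locale krein =
  fixes X :: "'a::ab_group_add ip_space"
  assumes krein: "krein_space X"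

sublocale krein \<subseteq> hermitian_form "scl X" "ip X"
  using krein unfolding krein_space_def by (blast intro: hermitian_form_ip)

context krein
begin

text \<open>
  The fundamental decomposition that \<^const>\<open>kp_norm\<close> selects, so that the facts below speak about that
  very norm and not about an equivalent one.
\<close>

definition Vp where "Vp = fst (SOME (P, N). fundamental_decomposition X P N)"
definition Vn where "Vn = snd (SOME (P, N). fundamental_decomposition X P N)"

lemma decomposition: "fundamental_decomposition X Vp Vn"
proof -
  have "\<exists>D. case D of (P, N) \<Rightarrow> fundamental_decomposition X P N"
    using krein unfolding krein_space_def by blast
  from someI_ex[OF this] show ?thesis
    by (cases "SOME (P, N). fundamental_decomposition X P N") (simp add: Vp_def Vn_def)
qed

lemma Vp_subspace: "subspace Vp" and Vn_subspace: "subspace Vn"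
  and Vp_hilbert: "hilbert_on (ip X) Vp" and Vn_hilbert: "hilbert_on (\<lambda>x y. - ip X x y) Vn"
  and orthogonal: "p \<in> Vp \<Longrightarrow> n \<in> Vn \<Longrightarrow> ip X p n = 0"
  and Vp_Vn: "Vp \<inter> Vn = {0}"
  and decompose: "\<exists>p\<in>Vp. \<exists>n\<in>Vn. x = p + n"
  using decomposition unfolding fundamental_decomposition_def by blast+

sublocale pos: positive_form "scl X" "ip X" Vp
  using Vp_hilbert Vp_subspace by unfold_locales (auto simp: hilbert_on_def)

sublocale neg: positive_form "scl X" "\<lambda>x y. - ip X x y" Vn
  using Vn_hilbert Vn_subspace uminus_form
  by (auto simp: positive_form_def positive_form_axioms_def hilbert_on_def)

lemma orthogonal': "p \<in> Vp \<Longrightarrow> n \<in> Vn \<Longrightarrow> ip X n p = 0"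
  using orthogonal commute[of p n] by simp

text \<open>
  The projections to the two summands of the decomposition.
\<close>

definition pp :: "'a \<Rightarrow> 'a" where "pp x = (THE p. p \<in> Vp \<and> x - p \<in> Vn)"
definition np :: "'a \<Rightarrow> 'a" where "np x = x - pp x"

lemma pp_eqI:
  assumes "p \<in> Vp" "n \<in> Vn" "x = p + n"
  shows "pp x = p" "np x = n"
proof -
  show "pp x = p"
    unfolding pp_def
  proof (rule the_equality)
    fix q assume q: "q \<in> Vp \<and> x - q \<in> Vn"
    have "p - q \<in> Vp" using q assms subspace_diff[OF Vp_subspace] by blast
    moreover have "p - q = (x - q) - n" using assms by simp
    hence "p - q \<in> Vn" using q assms subspace_diff[OF Vn_subspace] by metis
    ultimately have "p - q = 0" using Vp_Vn by blast
    thus "q = p" by simp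
  qed (use assms in simp)
  thus "np x = n" using assms by (simp add: np_def)
qed

lemma pp_in [simp]: "pp x \<in> Vp" and np_in [simp]: "np x \<in> Vn" and pp_np: "pp x + np x = x"
proof -
  obtain p n where "p \<in> Vp" "n \<in> Vn" "x = p + n" using decompose by blast
  with pp_eqI[OF this] show "pp x \<in> Vp" "np x \<in> Vn" "pp x + np x = x" by simp_all
qed

lemma pp_add: "pp (x + y) = pp x + pp y" and np_add: "np (x + y) = np x + np y"
proof -
  have "x + y = (pp x + pp y) + (np x + np y)" by (simp add: np_def)
  from pp_eqI[OF subspace_add[OF Vp_subspace pp_in pp_in] subspace_add[OF Vn_subspace np_in np_in] this]
  show "pp (x + y) = pp x + pp y" "np (x + y) = np x + np y" .
qed

lemma pp_scale: "pp (scl X c x) = scl X c (pp x)" and np_scale: "np (scl X c x) = scl X c (np x)"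
proof -
  have "scl X c x = scl X c (pp x) + scl X c (np x)" by (simp add: np_def flip: scale_right_distrib)
  from pp_eqI[OF subspace_scale[OF Vp_subspace pp_in] subspace_scale[OF Vn_subspace np_in] this]
  show "pp (scl X c x) = scl X c (pp x)" "np (scl X c x) = scl X c (np x)" .
qed

lemma np_diff: "np (x - y) = np x - np y" and pp_diff: "pp (x - y) = pp x - pp y"
  using np_add[of "x - y" y] pp_add[of "x - y" y] by (simp_all add: algebra_simps)

lemma ip_pp_np: "ip X x y = ip X (pp x) (pp y) + ip X (np x) (np y)"
proof -
  have "ip X x y = ip X (pp x + np x) (pp y + np y)" by (simp add: pp_np)
  thus ?thesis by (simp add: form_simps orthogonal orthogonal')
qed

text \<open>
  The fundamental symmetry. It is an isometric involution, and \<open>ip X (J x) y\<close> is the Hilbert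
  space inner product whose norm is \<^term>\<open>kp_norm X\<close>.
\<close>

definition J :: "'a \<Rightarrow> 'a" where "J x = pp x - np x"

lemma pp_J [simp]: "pp (J x) = pp x" and np_J [simp]: "np (J x) = - np x"
  using pp_eqI[OF pp_in subspace_neg[OF Vn_subspace np_in], of "J x" x x] by (simp_all add: J_def)

lemma J_J [simp]: "J (J x) = x"
  unfolding J_def[of "J x"] by (simp add: pp_np)

lemma J_add: "J (x + y) = J x + J y" and J_scale: "J (scl X c x) = scl X c (J x)"
  by (simp_all add: J_def pp_add np_add pp_scale np_scale scale_right_diff_distrib)

lemma ip_J_J: "ip X (J x) (J y) = ip X x y"
  unfolding ip_pp_np[of "J x"] ip_pp_np[of x] by (simp add: form_simps)

lemma ip_J: "ip X (J x) y = ip X x (J y)"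
  using ip_J_J[of x "J y"] by simp

lemma ip_J_pp_np: "ip X (J x) y = ip X (pp x) (pp y) - ip X (np x) (np y)"
  unfolding ip_pp_np[of "J x"] by (simp add: form_simps)

lemma J_form_pos:
  assumes "x \<noteq> 0"
  shows "0 < Re (ip X (J x) x)"
proof -
  have "pp x \<noteq> 0 \<or> np x \<noteq> 0" using assms pp_np[of x] by auto
  moreover have "0 \<le> Re (ip X (pp x) (pp x))" "0 \<le> Re (- ip X (np x) (np x))"
    using pos.nonneg[of "pp x"] neg.nonneg[of "np x"] by auto
  ultimately show ?thesis
    using pos.positive[of "pp x"] neg.positive[of "np x"] by (auto simp: ip_J_pp_np)
qed

sublocale hil: positive_form "scl X" "\<lambda>x y. ip X (J x) y" UNIV
proof
  fix x y z c
  show "ip X (J (x + y)) z = ip X (J x) z + ip X (J y) z"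
    "ip X (J (scl X c x)) z = c * ip X (J x) z"
    by (simp_all add: J_add J_scale form_simps)
  show "ip X (J y) x = cnj (ip X (J x) y)"
    using commute[of y "J x"] ip_J[of y x] by simp
qed (use J_form_pos in auto)

lemma kp_norm_eq: "kp_norm X x = sqrt (Re (ip X (J x) x))"
proof -
  obtain P N where PN: "(SOME (P, N). fundamental_decomposition X P N) = (P, N)" by fastforce
  hence V: "P = Vp" "N = Vn" by (simp_all add: Vp_def Vn_def)
  have "kp_norm X x =
    (THE r. \<exists>p\<in>Vp. \<exists>n\<in>Vn. x = p + n \<and> r = sqrt (Re (ip X p p) - Re (ip X n n)))"
    unfolding kp_norm_def PN by (simp add: V)
  also have "\<dots> = sqrt (Re (ip X (pp x) (pp x)) - Re (ip X (np x) (np x)))"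
  proof (rule the_equality)
    show "\<exists>p\<in>Vp. \<exists>n\<in>Vn. x = p + n \<and> sqrt (Re (ip X (pp x) (pp x)) - Re (ip X (np x) (np x)))
      = sqrt (Re (ip X p p) - Re (ip X n n))"
      using pp_in np_in pp_np by metis
  qed (auto simp: pp_eqI)
  finally show ?thesis by (simp add: ip_J_pp_np)
qed

lemma hil_nrm [simp]: "hil.nrm x = kp_norm X x"
  unfolding kp_norm_eq hil.nrm_def using hil.nonneg[of x] by simp

lemma kp_norm_nonneg [simp]: "0 \<le> kp_norm X x"
  using hil.nrm_nonneg[of x] by simp

lemma kp_norm_J [simp]: "kp_norm X (J x) = kp_norm X x"
  by (simp add: kp_norm_eq ip_J)

lemma kp_norm_sq: "(kp_norm X x)\<^sup>2 = Re (ip X (J x) x)"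
  using hil.nrm_sq[of x] by simp

lemma kp_norm_eq_0: "kp_norm X x = 0 \<longleftrightarrow> x = 0"
  using hil.nrm_eq_0[of x] by simp

lemma kp_norm_scale: "kp_norm X (scl X c x) = cmod c * kp_norm X x"
  using hil.nrm_scale[of c x] by simp

lemma kp_norm_zero [simp]: "kp_norm X 0 = 0"
  by (simp add: kp_norm_eq_0)

lemma kp_norm_minus [simp]: "kp_norm X (- x) = kp_norm X x"
  using hil.nrm_minus[of x] by simp

text \<open>
  The Cauchy-Schwarz inequality of the Hilbert space inner product carries over to the
  indefinite one because \<open>J\<close> is an isometry for both.
\<close>

lemma ip_bound: "cmod (ip X x y) \<le> kp_norm X x * kp_norm X y"
  using hil.Cauchy_Schwarz[of "J x" y] by simp

text \<open>
  A nonzero \<open>x\<close> is detected by \<open>J x\<close>.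
\<close>

lemma nondegenerate: "(\<And>y. ip X x y = 0) \<Longrightarrow> x = 0"
  using J_form_pos[of x] ip_J[of x x] by (cases "x = 0") auto

lemma ip_eqI: "(\<And>z. ip X x z = ip X y z) \<Longrightarrow> x = y"
  using nondegenerate[of "x - y"] by (simp add: form_simps)

lemma ip_eqI_right: "(\<And>z. ip X z x = ip X z y) \<Longrightarrow> x = y"
  using ip_eqI[of x y] commute[of x] commute[of y] by simp

sublocale met: Metric_space UNIV "\<lambda>x y. kp_norm X (x - y)"
  using hil.metric by simp

lemma kp_topology_eq: "kp_topology X = met.mtopology"
  by (simp add: kp_topology_def)

text \<open>
  The projections of a Cauchy sequence are Cauchy in the two complete summands, since each
  of them contributes a nonnegative term to the square of the norm.
\<close>

lemma complete: "hilbert_on (\<lambda>x y. ip X (J x) y) UNIV"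
  unfolding hil.hilbert_on_iff hil_nrm
proof (intro allI impI)
  fix \<sigma> :: "nat \<Rightarrow> 'a"
  assume C: "\<forall>e>0. \<exists>N. \<forall>m\<ge>N. \<forall>n\<ge>N. kp_norm X (\<sigma> m - \<sigma> n) < e"
  have sq: "(kp_norm X x)\<^sup>2 = (pos.nrm (pp x))\<^sup>2 + (neg.nrm (np x))\<^sup>2" for x
    by (simp add: kp_norm_sq pos.nrm_sq neg.nrm_sq ip_J_pp_np)
  have le: "pos.nrm (pp x) \<le> kp_norm X x" "neg.nrm (np x) \<le> kp_norm X x" for x
    by (rule power2_le_imp_le; simp add: sq)+
  have "\<forall>e>0. \<exists>N. \<forall>m\<ge>N. \<forall>n\<ge>N. pos.nrm (pp (\<sigma> m) - pp (\<sigma> n)) < e"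
    "\<forall>e>0. \<exists>N. \<forall>m\<ge>N. \<forall>n\<ge>N. neg.nrm (np (\<sigma> m) - np (\<sigma> n)) < e"
    unfolding pp_diff[symmetric] np_diff[symmetric] using C le by (meson le_less_trans)+
  then obtain p n where pn: "p \<in> Vp" "n \<in> Vn"
    and lim: "(\<lambda>k. pos.nrm (pp (\<sigma> k) - p)) \<longlonglongrightarrow> 0" "(\<lambda>k. neg.nrm (np (\<sigma> k) - n)) \<longlonglongrightarrow> 0"
    using Vp_hilbert[unfolded pos.hilbert_on_iff, rule_format, of "\<lambda>k. pp (\<sigma> k)"]
      Vn_hilbert[unfolded neg.hilbert_on_iff, rule_format, of "\<lambda>k. np (\<sigma> k)"] by auto
  have "(\<lambda>k. sqrt ((pos.nrm (pp (\<sigma> k) - p))\<^sup>2 + (neg.nrm (np (\<sigma> k) - n))\<^sup>2)) \<longlonglongrightarrow> sqrt (0\<^sup>2 + 0\<^sup>2)"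
    by (intro tendsto_intros lim)
  moreover have "sqrt ((pos.nrm (pp (\<sigma> k) - p))\<^sup>2 + (neg.nrm (np (\<sigma> k) - n))\<^sup>2)
      = kp_norm X (\<sigma> k - (p + n))" for k
    using sq[of "\<sigma> k - (p + n)"] pp_eqI[OF pn refl]
    by (simp add: pp_diff np_diff real_sqrt_unique)
  ultimately show "\<exists>l\<in>UNIV. (\<lambda>k. kp_norm X (\<sigma> k - l)) \<longlonglongrightarrow> 0"
    by auto
qed

lemma Cauchy_convergent:
  assumes "\<And>e. e > 0 \<Longrightarrow> \<exists>N. \<forall>m\<ge>N. \<forall>n\<ge>N. kp_norm X (\<sigma> m - \<sigma> n) < e"
  obtains l where "(\<lambda>n. kp_norm X (\<sigma> n - l)) \<longlonglongrightarrow> 0"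
  using complete[unfolded hil.hilbert_on_iff, rule_format, of \<sigma>] assms by auto

lemma mcomplete: "met.mcomplete"
  using complete unfolding hilbert_on_def kp_norm_eq using hil.nonneg by (simp add: abs_of_nonneg)

end

section \<open>Representation of functionals, adjoints and boundedness\<close>

context krein
begin

lemma continuous_ip: "continuous_map (kp_topology X) euclidean (\<lambda>x. ip X x y)"
proof -
  have "\<exists>d>0. \<forall>x. kp_norm X (a - x) < d \<longrightarrow> dist (ip X a y) (ip X x y) < e" if "e > 0" for a e
  proof (intro exI conjI allI impI)
    let ?d = "e / (kp_norm X y + 1)"
    show "?d > 0" using that by (simp add: add_nonneg_pos)
    fix x assume x: "kp_norm X (a - x) < ?d"
    have "dist (ip X a y) (ip X x y) = cmod (ip X (a - x) y)"
      by (simp add: dist_norm form_simps)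
    also have "\<dots> \<le> kp_norm X (a - x) * kp_norm X y" by (rule ip_bound)
    also have "\<dots> \<le> kp_norm X (a - x) * (kp_norm X y + 1)" by (simp add: algebra_simps)
    also have "\<dots> < e" using x by (simp add: add_nonneg_pos pos_less_divide_eq)
    finally show "dist (ip X a y) (ip X x y) < e" .
  qed
  thus ?thesis
    using met.metric_continuous_map[OF Met_TC.Metric_space_axioms, of "\<lambda>x. ip X x y"]
    unfolding kp_topology_eq by auto
qed

lemma closedin_rel_adjoint: "closedin (topology2 X) (rel_adjoint X A)"
proof -
  have top: "topspace (topology2 X) = UNIV"
    by (simp add: topology2_def kp_topology_eq)
  have cont: "continuous_map (topology2 X) euclidean (\<lambda>f. ip X (fst f) g' - ip X (snd f) g)" for g g'
  proof (rule continuous_map_diff)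
    show "continuous_map (topology2 X) euclidean (\<lambda>f. ip X (fst f) g')"
      unfolding topology2_def
      using continuous_map_compose[OF continuous_map_fst continuous_ip, of "kp_topology X" g']
      by (simp add: o_def)
    show "continuous_map (topology2 X) euclidean (\<lambda>f. ip X (snd f) g)"
      unfolding topology2_def
      using continuous_map_compose[OF continuous_map_snd continuous_ip, of "kp_topology X" g]
      by (simp add: o_def)
  qed
  have "closedin (topology2 X) {f. ip2 X f (g, g') = 0}" for g g'
    using closedin_continuous_map_preimage[OF cont, of "{0}" g' g]
    by (simp add: top ip2_def split_beta)
  hence "closedin (topology2 X) (\<Inter>g\<in>insert 0 A. {f. ip2 X f g = 0})"
    by (intro closedin_INT) auto
  moreover have "ip2 X f 0 = 0" for f
    by (simp add: ip2_def zero_prod_def split_beta)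
  hence "(\<Inter>g\<in>insert 0 A. {f. ip2 X f g = 0}) = rel_adjoint X A"
    by (auto simp: rel_adjoint_def)
  ultimately show ?thesis by simp
qed

text \<open>
  The vectors orthogonal to \<open>y\<close> form a closed subspace.
\<close>

lemma orthogonal_dense:
  assumes "kp_topology X closure_of span M = UNIV" and "\<And>x. x \<in> M \<Longrightarrow> ip X x y = 0"
  shows "y = 0"
proof (rule nondegenerate)
  have "subspace {x. ip X x y = 0}"
    by (intro subspaceI) (auto simp: form_simps)
  hence "span M \<subseteq> {x. ip X x y = 0}"
    using assms(2) by (intro span_minimal) auto
  moreover have "closedin (kp_topology X) {x. ip X x y = 0}"
    using closedin_continuous_map_preimage[OF continuous_ip, of "{0}" y] by (simp add: kp_topology_eq)
  ultimately have "UNIV \<subseteq> {x. ip X x y = 0}"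
    using closure_of_minimal assms(1) by metis
  hence "ip X x y = 0" for x by blast
  thus "ip X y x = 0" for x
    using commute[of x y] by simp
qed

text \<open>
  The representing vector is found by minimising \<open>F x = \<parallel>x\<parallel>\<^sup>2 - 2 Re (\<phi> x)\<close>. The parallelogram law
  makes every minimising sequence Cauchy; varying its terms in the direction \<open>y\<close> identifies
  \<open>Re \<phi>\<close> with the real part of the product with the limit, and replacing \<open>y\<close> by \<open>\<i> y\<close> gives the
  imaginary part. The fundamental symmetry translates the result to the indefinite product.
\<close>

lemma Riesz:
  assumes add: "\<And>x y. \<phi> (x + y) = \<phi> x + \<phi> y"
    and scale: "\<And>c x. \<phi> (scl X c x) = c * \<phi> x"
    and bound: "\<And>x. cmod (\<phi> x) \<le> c * kp_norm X x"
  shows "\<exists>z. \<forall>x. \<phi> x = ip X x z"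
proof -
  define F where "F x = (kp_norm X x)\<^sup>2 - 2 * Re (\<phi> x)" for x
  define m where "m = (INF x. F x)"
  \<comment> \<open>By completing the square.\<close>
  have "- c\<^sup>2 \<le> F x" for x
  proof -
    have "Re (\<phi> x) \<le> c * kp_norm X x"
      using bound[of x] complex_Re_le_cmod[of "\<phi> x"] by simp
    moreover have "0 \<le> (kp_norm X x - c)\<^sup>2" by simp
    ultimately show ?thesis by (simp add: F_def power2_diff algebra_simps)
  qed
  hence "bdd_below (range F)" by (intro bdd_belowI) auto
  hence m_le: "m \<le> F x" for x by (simp add: m_def cINF_lower)
  have "\<exists>x. F x < m + inverse (real (Suc n))" for n
    using cInf_lessD[of "range F" "m + inverse (real (Suc n))"] by (auto simp: m_def)
  then obtain \<sigma> where \<sigma>: "\<And>n. F (\<sigma> n) < m + inverse (real (Suc n))" by metis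
  have expand: "F (x + y) = F x + (kp_norm X y)\<^sup>2 + 2 * Re (ip X y (J x) - \<phi> y)" for x y
    using commute[of y "J x"] by (simp add: F_def kp_norm_sq add J_add form_simps ip_J[of y x])
  have parallelogram: "(kp_norm X (x - y))\<^sup>2 \<le> 2 * F x + 2 * F y - 4 * m" for x y
  proof -
    let ?h = "scl X (1/2) (x + y)"
    have "4 * (kp_norm X ?h)\<^sup>2 = (kp_norm X (x + y))\<^sup>2"
      by (simp add: kp_norm_scale power_divide norm_divide)
    moreover have "(kp_norm X (x - y))\<^sup>2 + (kp_norm X (x + y))\<^sup>2
        = 2 * (kp_norm X x)\<^sup>2 + 2 * (kp_norm X y)\<^sup>2"
      unfolding kp_norm_sq by (simp add: hil.form_simps)
    moreover have "Re (\<phi> ?h) = (Re (\<phi> x) + Re (\<phi> y)) / 2"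
      by (simp add: add scale)
    ultimately have "(kp_norm X (x - y))\<^sup>2 = 2 * F x + 2 * F y - 4 * F ?h"
      unfolding F_def by (simp add: field_simps)
    thus ?thesis using m_le[of ?h] by simp
  qed
  obtain z where z: "(\<lambda>n. kp_norm X (\<sigma> n - z)) \<longlonglongrightarrow> 0"
  proof (rule Cauchy_convergent)
    fix e :: real assume "e > 0"
    then obtain N where N: "inverse (real (Suc N)) < e\<^sup>2 / 4"
      using reals_Archimedean[of "e\<^sup>2 / 4"] by auto
    have "kp_norm X (\<sigma> k - \<sigma> n) < e" if "k \<ge> N" "n \<ge> N" for k n
    proof -
      have "(kp_norm X (\<sigma> k - \<sigma> n))\<^sup>2 \<le> 2 * F (\<sigma> k) + 2 * F (\<sigma> n) - 4 * m"
        by (rule parallelogram)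
      also have "\<dots> < 2 * inverse (real (Suc k)) + 2 * inverse (real (Suc n))"
        using \<sigma>[of k] \<sigma>[of n] by simp
      also have "\<dots> \<le> 2 * inverse (real (Suc N)) + 2 * inverse (real (Suc N))"
        using that by (intro add_mono mult_left_mono le_imp_inverse_le) auto
      also have "\<dots> < e\<^sup>2" using N by simp
      finally show ?thesis using \<open>e > 0\<close> power2_less_imp_less by force
    qed
    thus "\<exists>N. \<forall>k\<ge>N. \<forall>n\<ge>N. kp_norm X (\<sigma> k - \<sigma> n) < e" by blast
  qed
  have real_part: "Re (\<phi> y) = Re (ip X y (J z))" for y
  proof -
    define d where "d = Re (ip X y (J z) - \<phi> y)"
    have limit: "0 \<le> t\<^sup>2 * (kp_norm X y)\<^sup>2 + 2 * t * d" for t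
    proof (rule LIMSEQ_le)
      show "(\<lambda>n. - inverse (real (Suc n))) \<longlonglongrightarrow> 0"
        using tendsto_minus[OF LIMSEQ_inverse_real_of_nat] by simp
      have "(\<lambda>n. ip X y (J (\<sigma> n - z))) \<longlonglongrightarrow> 0"
      proof (rule Lim_null_comparison)
        show "\<forall>\<^sub>F n in sequentially. norm (ip X y (J (\<sigma> n - z))) \<le> kp_norm X y * kp_norm X (\<sigma> n - z)"
          using ip_bound[of y "J _"] by simp
        show "(\<lambda>n. kp_norm X y * kp_norm X (\<sigma> n - z)) \<longlonglongrightarrow> 0"
          using tendsto_mult_right_zero[OF z] .
      qed
      hence "(\<lambda>n. t\<^sup>2 * (kp_norm X y)\<^sup>2 + 2 * t * (Re (ip X y (J (\<sigma> n - z))) + d))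
          \<longlonglongrightarrow> t\<^sup>2 * (kp_norm X y)\<^sup>2 + 2 * t * (Re 0 + d)"
        by (intro tendsto_intros)
      moreover have "Re (ip X y (J (\<sigma> n - z))) + d = Re (ip X y (J (\<sigma> n)) - \<phi> y)" for n
        using J_add[of "\<sigma> n - z" z] by (simp add: d_def form_simps)
      ultimately show "(\<lambda>n. t\<^sup>2 * (kp_norm X y)\<^sup>2 + 2 * t * (Re (ip X y (J (\<sigma> n)) - \<phi> y)))
          \<longlonglongrightarrow> t\<^sup>2 * (kp_norm X y)\<^sup>2 + 2 * t * d" by simp
      have "- inverse (real (Suc n)) \<le> t\<^sup>2 * (kp_norm X y)\<^sup>2 + 2 * t * (Re (ip X y (J (\<sigma> n)) - \<phi> y))" for n
        using m_le[of "\<sigma> n + scl X (of_real t) y"] \<sigma>[of n]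
        unfolding expand by (simp add: scale kp_norm_scale power_mult_distrib form_simps algebra_simps)
      thus "\<exists>N. \<forall>n\<ge>N. - inverse (real (Suc n))
          \<le> t\<^sup>2 * (kp_norm X y)\<^sup>2 + 2 * t * (Re (ip X y (J (\<sigma> n)) - \<phi> y))" by blast
    qed
    have ge: "0 \<le> t\<^sup>2 * ((kp_norm X y)\<^sup>2 + 1) + 2 * t * d" for t
      using limit[of t] zero_le_power2[of t] unfolding distrib_left by linarith
    define a where "a = (kp_norm X y)\<^sup>2 + 1"
    have "a > 0" by (simp add: a_def add_nonneg_pos)
    \<comment> \<open>A quadratic with positive leading coefficient is negative at its vertex unless \<open>d = 0\<close>; adding 1
      to the leading coefficient covers the case \<open>y = 0\<close>.\<close>
    have "0 \<le> (- d / a)\<^sup>2 * a + 2 * (- d / a) * d" using ge unfolding a_def .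
    also have "\<dots> = - (d\<^sup>2 / a)" using \<open>a > 0\<close> by (simp add: field_simps power2_eq_square)
    finally have "d\<^sup>2 / a \<le> 0" by simp
    hence "d = 0" using \<open>a > 0\<close> by (simp add: divide_le_0_iff)
    thus ?thesis by (simp add: d_def)
  qed
  have "\<phi> y = ip X y (J z)" for y
    using real_part[of y] real_part[of "scl X \<i> y"] by (simp add: complex_eq_iff scale form_simps)
  thus ?thesis by blast
qed

text \<open>
  The Hellinger-Toeplitz theorem. It makes boundedness independent of the fundamental
  decomposition: for an orthogonal sum, the norm selected by \<^const>\<open>kp_norm\<close> need not be built from the
  norms of the summands, whereas adjoints of operators on the sum are computed from the form alone.
  The set \<open>C n\<close> of all \<open>x\<close> with \<open>\<parallel>R x\<parallel> \<le> n\<close> is closed because the functionals \<open>[R x, y] = [x, R' y]\<close> are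
  continuous, so Baire's theorem yields a ball on which \<open>R\<close> is bounded.
\<close>

lemma bounded_if_adjoint:
  assumes adj: "\<And>x y. ip X (R x) y = ip X x (R' y)"
  shows "R \<in> bounded_ops X X"
proof -
  have add: "R (x + y) = R x + R y" and scale: "R (scl X c x) = scl X c (R x)" for x y c
    by (rule ip_eqI; simp add: adj form_simps)+
  have lin: "Vector_Spaces.linear (scl X) (scl X) R"
    by unfold_locales (rule add, rule scale)
  define C where "C n = {x. \<forall>y. kp_norm X y \<le> 1 \<longrightarrow> cmod (ip X (R x) y) \<le> real n}" for n
  have closed: "closedin met.mtopology (C n)" for n
  proof -
    have "closedin met.mtopology {x. cmod (ip X x (R' y)) \<le> real n}" for y
      using closedin_continuous_map_preimage[OF continuous_ip, of "cball 0 (real n)" "R' y"]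
      by (simp add: kp_topology_eq)
    hence "closedin met.mtopology (\<Inter>y\<in>{y. kp_norm X y \<le> 1}. {x. cmod (ip X x (R' y)) \<le> real n})"
      by (intro closedin_INT) (auto intro: exI[of _ 0])
    also have "(\<Inter>y\<in>{y. kp_norm X y \<le> 1}. {x. cmod (ip X x (R' y)) \<le> real n}) = C n"
      by (auto simp: C_def adj)
    finally show ?thesis .
  qed
  have "(\<Union>n. C n) = UNIV"
  proof -
    have "\<exists>n. x \<in> C n" for x
    proof -
      obtain n where n: "kp_norm X (R x) \<le> real n" using real_arch_simple by blast
      have "cmod (ip X (R x) y) \<le> real n" if "kp_norm X y \<le> 1" for y
        using ip_bound[of "R x" y] mult_left_mono[OF that kp_norm_nonneg, of "R x"] n by simp
      thus ?thesis by (auto simp: C_def)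
    qed
    thus ?thesis by blast
  qed
  hence "met.mtopology interior_of (\<Union> (range C)) \<noteq> {}"
    using interior_of_topspace[of met.mtopology] by simp
  then obtain n where "met.mtopology interior_of C n \<noteq> {}"
    using met.metric_Baire_category_alt[OF mcomplete, of "range C"] closed by fastforce
  then obtain x0 where "x0 \<in> met.mtopology interior_of C n" by blast
  moreover have "openin met.mtopology (met.mtopology interior_of C n)" by simp
  ultimately obtain r where r: "r > 0" and "met.mball x0 r \<subseteq> met.mtopology interior_of C n"
    unfolding met.openin_mtopology by blast
  hence ball: "met.mball x0 r \<subseteq> C n"
    using interior_of_subset[of met.mtopology "C n"] by blast
  have small: "kp_norm X (R x) \<le> 2 * real n" if x: "kp_norm X x < r" for x
  proof (cases "R x = 0")
    case False
    define k where "k = kp_norm X (R x)"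
    have k: "k > 0" using False kp_norm_eq_0[of "R x"] by (simp add: k_def order_less_le)
    define y where "y = scl X (of_real (1 / k)) (J (R x))"
    have y: "kp_norm X y \<le> 1" using k by (simp add: y_def kp_norm_scale norm_divide flip: k_def)
    have "x0 + x \<in> C n" "x0 \<in> C n"
      using ball r x by (auto simp: subset_iff)
    hence *: "cmod (ip X (R (x0 + x)) y) \<le> n" "cmod (ip X (R x0) y) \<le> n"
      using y by (auto simp: C_def)
    have "Re (ip X (R x) (J (R x))) = k\<^sup>2"
      by (simp add: k_def kp_norm_sq ip_J)
    hence "k = Re (ip X (R x) y)"
      using k by (simp add: y_def form_simps power2_eq_square)
    also have "\<dots> \<le> cmod (ip X (R (x0 + x)) y - ip X (R x0) y)"
      using complex_Re_le_cmod[of "ip X (R x) y"] by (simp add: add form_simps)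
    also have "\<dots> \<le> 2 * n"
      using norm_triangle_ineq4[of "ip X (R (x0 + x)) y" "ip X (R x0) y"] * by simp
    finally show ?thesis by (simp add: k_def)
  qed simp
  have "kp_norm X (R x) \<le> (4 * real n / r) * kp_norm X x" for x
  proof (cases "x = 0")
    case True
    have "R 0 = 0" using add[of 0 0] by simp
    thus ?thesis using True by simp
  next
    case False
    define t where "t = r / (2 * kp_norm X x)"
    have k: "kp_norm X x > 0" using False kp_norm_eq_0[of x] by (simp add: order_less_le)
    hence t: "t > 0" using r by (simp add: t_def)
    have "kp_norm X (scl X (of_real t) x) = r / 2"
      using k t by (simp add: kp_norm_scale) (simp add: t_def)
    hence "t * kp_norm X (R x) \<le> 2 * real n"
      using small[of "scl X (of_real t) x"] r t by (simp add: scale kp_norm_scale)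
    thus ?thesis using k r by (simp add: t_def field_simps)
  qed
  hence "\<exists>c. \<forall>x. kp_norm X (R x) \<le> c * kp_norm X x" by blast
  thus ?thesis using lin by (simp add: bounded_ops_def)
qed

end

lemma bounded_opsD:
  assumes "B \<in> bounded_ops X Y"
  shows "B (x + y) = B x + B y" "B (scl X c x) = scl Y c (B x)"
proof -
  interpret Vector_Spaces.linear "scl X" "scl Y" B using assms by (simp add: bounded_ops_def)
  show "B (x + y) = B x + B y" "B (scl X c x) = scl Y c (B x)" by (rule add, rule scale)
qed

text \<open>
  Existence by the Riesz theorem, uniqueness by nondegeneracy; both are needed since
  \<^const>\<open>op_adjoint\<close> is a definite description.
\<close>

lemma op_adjoint:
  assumes "krein_space X" "krein_space Y" and B: "B \<in> bounded_ops X Y"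
  shows "ip Y (B x) y = ip X x (op_adjoint X Y B y)"
proof -
  interpret X: krein X by unfold_locales (rule assms)
  interpret Y: krein Y by unfold_locales (rule assms)
  obtain c where c: "\<And>x. kp_norm Y (B x) \<le> c * kp_norm X x"
    using B by (auto simp: bounded_ops_def)
  have "\<exists>z. \<forall>x. ip Y (B x) y = ip X x z" for y
  proof (rule X.Riesz)
    fix x
    have "cmod (ip Y (B x) y) \<le> kp_norm Y (B x) * kp_norm Y y" by (rule Y.ip_bound)
    also have "\<dots> \<le> (c * kp_norm X x) * kp_norm Y y" by (intro mult_right_mono c) simp
    finally show "cmod (ip Y (B x) y) \<le> (c * kp_norm Y y) * kp_norm X x" by (simp add: mult_ac)
  qed (simp_all add: bounded_opsD[OF B] Y.form_simps)
  then obtain C where C: "\<And>x y. ip Y (B x) y = ip X x (C y)" by metis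
  have "op_adjoint X Y B = C"
    unfolding op_adjoint_def
  proof (rule the_equality)
    fix C' assume "\<forall>x y. ip Y (B x) y = ip X x (C' y)"
    thus "C' = C" using C by (intro ext X.ip_eqI_right) metis
  qed (use C in blast)
  thus ?thesis using C by simp
qed

section \<open>Selfadjoint relations and resolvents\<close>

lemma resolvent_relation_iff:
  fixes X :: "'a::ab_group_add ip_space"
  shows "(y, f) \<in> resolvent_relation X A z \<longleftrightarrow> (f, y + scl X z f) \<in> A"
proof
  assume "(f, y + scl X z f) \<in> A"
  hence "((y + scl X z f) - scl X z f, f) \<in> resolvent_relation X A z"
    unfolding resolvent_relation_def by blast
  thus "(y, f) \<in> resolvent_relation X A z" by simp
qed (auto simp: resolvent_relation_def)

context krein
begin

lemma module_scl2: "module (scl2 X)"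
  by unfold_locales (auto simp: scl2_def algebra_simps)

lemma linear_relation_iff:
  "linear_relation X A \<longleftrightarrow>
    0 \<in> A \<and> (\<forall>f\<in>A. \<forall>g\<in>A. f + g \<in> A) \<and> (\<forall>c. \<forall>f\<in>A. scl2 X c f \<in> A)"
  unfolding linear_relation_def module.subspace_def[OF module_scl2] by blast

lemma linear_relation_diff:
  assumes "linear_relation X A" "f \<in> A" "g \<in> A"
  shows "f - g \<in> A"
  using assms module.subspace_diff[OF module_scl2] by (auto simp: linear_relation_def)

lemma rel_adjoint_iff:
  "(f, f') \<in> rel_adjoint X A \<longleftrightarrow> (\<forall>g g'. (g, g') \<in> A \<longrightarrow> ip X f g' = ip X f' g)"
  by (auto simp: rel_adjoint_def ip2_def)

lemma linear_relation_rel_adjoint: "linear_relation X (rel_adjoint X A)"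
  unfolding linear_relation_iff
  by (auto simp: rel_adjoint_iff zero_prod_def scl2_def form_simps)

lemma rel_adjoint_antimono: "A \<subseteq> B \<Longrightarrow> rel_adjoint X B \<subseteq> rel_adjoint X A"
  by (auto simp: rel_adjoint_def)

lemma resolvent_setI:
  assumes R: "R \<in> bounded_ops X X"
    and graph: "\<And>f f'. (f, f') \<in> A \<longleftrightarrow> f = R (f' - scl X z f)"
  shows "z \<in> resolvent_set X A" "resolvent_op X A z = R"
proof -
  have *: "resolvent_relation X A z = {(x, R x) | x. True}"
    by (auto simp: resolvent_relation_iff graph)
  thus "z \<in> resolvent_set X A" using R by (auto simp: resolvent_set_def)
  show "resolvent_op X A z = R" by (simp add: fun_eq_iff resolvent_op_def *)
qed

lemma
  assumes "z \<in> resolvent_set X A"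
  shows resolvent_bounded: "resolvent_op X A z \<in> bounded_ops X X"
    and resolvent_iff: "(f, f') \<in> A \<longleftrightarrow> f = resolvent_op X A z (f' - scl X z f)"
proof -
  obtain R where R: "R \<in> bounded_ops X X" "resolvent_relation X A z = {(x, R x) | x. True}"
    using assms by (auto simp: resolvent_set_def)
  have op: "resolvent_op X A z = R" by (simp add: fun_eq_iff resolvent_op_def R)
  show "resolvent_op X A z \<in> bounded_ops X X" by (simp add: op R)
  have "(f, f') \<in> A \<longleftrightarrow> (f' - scl X z f, f) \<in> resolvent_relation X A z"
    by (simp add: resolvent_relation_iff)
  thus "(f, f') \<in> A \<longleftrightarrow> f = resolvent_op X A z (f' - scl X z f)"
    by (auto simp: R op)
qed

lemma resolvent_in:
  assumes "z \<in> resolvent_set X A"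
  shows "(resolvent_op X A z k, k + scl X z (resolvent_op X A z k)) \<in> A"
  by (simp add: resolvent_iff[OF assms])

lemma resolvent_zero:
  assumes "z \<in> resolvent_set X A"
  shows "resolvent_op X A z 0 = 0"
  using bounded_opsD(1)[OF resolvent_bounded[OF assms], of 0 0] by simp

lemma selfadjoint_iff:
  assumes "selfadjoint_relation X A"
  shows "(f, f') \<in> A \<longleftrightarrow> (\<forall>g g'. (g, g') \<in> A \<longrightarrow> ip X f g' = ip X f' g)"
  using assms rel_adjoint_iff[of f f' A] by (simp add: selfadjoint_relation_def)

lemma selfadjointD:
  assumes "selfadjoint_relation X A" "(f, f') \<in> A" "(g, g') \<in> A"
  shows "ip X f g' = ip X f' g"
  using assms selfadjoint_iff by blast

text \<open>
  The adjoint \<open>R'\<close> of the resolvent at \<open>z\<close> is the resolvent at \<open>cnj z\<close>: as \<open>A\<close> consists of the pairs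
  \<open>(R k, k + z R k)\<close>, orthogonality of \<open>(f, f')\<close> to \<open>A\<close> says that \<open>f\<close> and \<open>R' (f' - cnj z f)\<close> have the same
  products with all \<open>k\<close>.
\<close>

lemma selfadjoint_resolvent_cnj:
  assumes A: "selfadjoint_relation X A" and z: "z \<in> resolvent_set X A"
  shows "cnj z \<in> resolvent_set X A"
proof -
  define R where "R = resolvent_op X A z"
  define R' where "R' = op_adjoint X X R"
  have adj: "ip X (R x) y = ip X x (R' y)" for x y
    unfolding R_def R'_def by (rule op_adjoint[OF krein krein resolvent_bounded[OF z]])
  have adj': "ip X (R' x) y = ip X x (R y)" for x y
    using adj[of y x] commute[of "R' x" y] commute[of x "R y"] by simp
  show ?thesis
  proof (rule resolvent_setI(1))
    show "R' \<in> bounded_ops X X" by (rule bounded_if_adjoint[OF adj'])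
    fix f f'
    have "(f, f') \<in> A \<longleftrightarrow> (\<forall>k. ip X f (k + scl X z (R k)) = ip X f' (R k))"
    proof
      assume "(f, f') \<in> A"
      thus "\<forall>k. ip X f (k + scl X z (R k)) = ip X f' (R k)"
        using selfadjoint_iff[OF A] resolvent_in[OF z] unfolding R_def by blast
    next
      assume eq: "\<forall>k. ip X f (k + scl X z (R k)) = ip X f' (R k)"
      show "(f, f') \<in> A"
      proof (rule iffD2[OF selfadjoint_iff[OF A]], intro allI impI)
        fix g g' assume "(g, g') \<in> A"
        hence "R (g' - scl X z g) = g" using resolvent_iff[OF z, of g g'] by (simp add: R_def)
        thus "ip X f g' = ip X f' g" using eq[rule_format, of "g' - scl X z g"] by simp
      qed
    qed
    also have "\<dots> \<longleftrightarrow> (\<forall>k. ip X f k = ip X (R' (f' - scl X (cnj z) f)) k)"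
      by (auto simp: adj' form_simps algebra_simps)
    also have "\<dots> \<longleftrightarrow> f = R' (f' - scl X (cnj z) f)"
      by (auto intro: ip_eqI)
    finally show "(f, f') \<in> A \<longleftrightarrow> f = R' (f' - scl X (cnj z) f)" .
  qed
qed

lemma resolvent_adjoint:
  assumes A: "selfadjoint_relation X A" and z: "z \<in> resolvent_set X A"
  shows "ip X (resolvent_op X A z x) y = ip X x (resolvent_op X A (cnj z) y)"
proof -
  have "ip X (resolvent_op X A z x) (y + scl X (cnj z) (resolvent_op X A (cnj z) y))
    = ip X (x + scl X z (resolvent_op X A z x)) (resolvent_op X A (cnj z) y)"
    using selfadjoint_iff[OF A] resolvent_in[OF z] resolvent_in[OF selfadjoint_resolvent_cnj[OF A z]]
    by blast
  thus ?thesis by (simp add: form_simps)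
qed

end

section \<open>Orthogonal sums\<close>

definition orth_sum :: "'a ip_space \<Rightarrow> 'b ip_space \<Rightarrow> ('a \<times> 'b) ip_space" where
  "orth_sum X Y = \<lparr>scl = \<lambda>c u. (scl X c (fst u), scl Y c (snd u)),
     ip = \<lambda>u v. ip X (fst u) (fst v) + ip Y (snd u) (snd v)\<rparr>"

lemma scl_orth_sum [simp]: "scl (orth_sum X Y) c (x, y) = (scl X c x, scl Y c y)"
  and ip_orth_sum [simp]: "ip (orth_sum X Y) (x, y) (x', y') = ip X x x' + ip Y y y'"
  by (simp_all add: orth_sum_def)

text \<open>
  Known as the antispace.
\<close>

definition anti :: "'a ip_space \<Rightarrow> 'a ip_space" where
  "anti X = \<lparr>scl = scl X, ip = \<lambda>x y. - ip X x y\<rparr>"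

lemma scl_anti [simp]: "scl (anti X) = scl X"
  and ip_anti [simp]: "ip (anti X) = (\<lambda>x y. - ip X x y)"
  by (simp_all add: anti_def)

lemma krein_space_anti:
  assumes "krein_space X"
  shows "krein_space (anti X)"
proof -
  interpret krein X by unfold_locales (rule assms)
  have "hermitian_space (anti X)"
    by (rule hermitian_spaceI) (simp add: uminus_form)
  moreover have "fundamental_decomposition (anti X) Vn Vp"
    unfolding fundamental_decomposition_def
  proof (intro conjI allI)
    fix x
    show "\<exists>p\<in>Vn. \<exists>n\<in>Vp. x = p + n"
      using decompose[of x] by (metis add.commute)
  qed (use Vp_subspace Vn_subspace Vp_hilbert Vn_hilbert Vp_Vn orthogonal' in \<open>auto simp: Int_commute\<close>)
  ultimately show ?thesis unfolding krein_space_def by blast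
qed

lemma krein_space_hilbert:
  assumes "hilbert_space X"
  shows "krein_space X"
proof -
  have X: "hermitian_space X" "hilbert_on (ip X) UNIV"
    using assms by (simp_all add: hilbert_space_def)
  interpret hermitian_form "scl X" "ip X" by (rule hermitian_form_ip[OF X(1)])
  interpret triv: hermitian_form "scl X" "\<lambda>x y. - ip X x y" by (rule uminus_form)
  interpret triv: positive_form "scl X" "\<lambda>x y. - ip X x y" "{0}"
    by unfold_locales auto
  have "hilbert_on (\<lambda>x y. - ip X x y) {0}"
    unfolding triv.hilbert_on_iff by (auto simp: triv.nrm_def)
  hence "fundamental_decomposition X UNIV {0}"
    using X(2) unfolding fundamental_decomposition_def by auto
  thus ?thesis using X(1) unfolding krein_space_def by blast
qed

lemma positive_form_Times:
  assumes "positive_form s1 b1 V1" "positive_form s2 b2 V2"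
  shows "positive_form (\<lambda>c u. (s1 c (fst u), s2 c (snd u)))
    (\<lambda>u v. b1 (fst u) (fst v) + b2 (snd u) (snd v)) (V1 \<times> V2)"
proof -
  interpret F1: positive_form s1 b1 V1 by (rule assms)
  interpret F2: positive_form s2 b2 V2 by (rule assms)
  interpret vector_space "\<lambda>c u. (s1 c (fst u), s2 c (snd u))"
    by unfold_locales (simp_all add: algebra_simps)
  show ?thesis
  proof
    show "subspace (V1 \<times> V2)"
      using F1.subspace F2.subspace
      by (auto simp: subspace_def F1.subspace_def F2.subspace_def zero_prod_def)
    fix u v
    show "b1 (fst v) (fst u) + b2 (snd v) (snd u) = cnj (b1 (fst u) (fst v) + b2 (snd u) (snd v))"
      using F1.commute[of "fst v" "fst u"] F2.commute[of "snd v" "snd u"] by simp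
  next
    fix u assume "u \<in> V1 \<times> V2" "u \<noteq> 0"
    thus "0 < Re (b1 (fst u) (fst u) + b2 (snd u) (snd u))"
      using F1.nonneg[of "fst u"] F2.nonneg[of "snd u"] F1.positive[of "fst u"] F2.positive[of "snd u"]
      by (cases "fst u = 0") (auto simp: prod_eq_iff add_pos_nonneg)
  qed (simp_all add: F1.form_simps F2.form_simps algebra_simps)
qed

lemma hilbert_on_Times:
  assumes "positive_form s1 b1 V1" "positive_form s2 b2 V2"
    and "hilbert_on b1 V1" "hilbert_on b2 V2"
  shows "hilbert_on (\<lambda>u v. b1 (fst u) (fst v) + b2 (snd u) (snd v)) (V1 \<times> V2)"
proof -
  interpret F1: positive_form s1 b1 V1 by (rule assms)
  interpret F2: positive_form s2 b2 V2 by (rule assms)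
  interpret F: positive_form "\<lambda>c u. (s1 c (fst u), s2 c (snd u))"
    "\<lambda>u v. b1 (fst u) (fst v) + b2 (snd u) (snd v)" "V1 \<times> V2"
    by (rule positive_form_Times[OF assms(1,2)])
  have nrm: "F.nrm u = sqrt ((F1.nrm (fst u))\<^sup>2 + (F2.nrm (snd u))\<^sup>2)" if "u \<in> V1 \<times> V2" for u
    using that by (auto simp: F1.nrm_sq F2.nrm_sq F.nrm_def F1.nonneg F2.nonneg)
  show ?thesis
    unfolding F.hilbert_on_iff
  proof (intro allI impI)
    fix \<sigma> :: "nat \<Rightarrow> _" assume in_V: "\<forall>n. \<sigma> n \<in> V1 \<times> V2"
      and C: "\<forall>e>0. \<exists>N. \<forall>m\<ge>N. \<forall>n\<ge>N. F.nrm (\<sigma> m - \<sigma> n) < e"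
    have diff: "\<sigma> m - \<sigma> n \<in> V1 \<times> V2" for m n
      using F.subspace_diff[OF F.subspace] in_V by blast
    have le: "F1.nrm (fst (\<sigma> m) - fst (\<sigma> n)) \<le> F.nrm (\<sigma> m - \<sigma> n)"
      "F2.nrm (snd (\<sigma> m) - snd (\<sigma> n)) \<le> F.nrm (\<sigma> m - \<sigma> n)" for m n
      unfolding nrm[OF diff] by (simp_all add: real_le_rsqrt)
    have "\<forall>e>0. \<exists>N. \<forall>m\<ge>N. \<forall>n\<ge>N. F1.nrm (fst (\<sigma> m) - fst (\<sigma> n)) < e"
      "\<forall>e>0. \<exists>N. \<forall>m\<ge>N. \<forall>n\<ge>N. F2.nrm (snd (\<sigma> m) - snd (\<sigma> n)) < e"
      using C le by (meson le_less_trans)+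
    moreover have "\<forall>n. fst (\<sigma> n) \<in> V1" "\<forall>n. snd (\<sigma> n) \<in> V2"
      using in_V by (auto simp: mem_Times_iff)
    ultimately obtain x y where xy: "x \<in> V1" "y \<in> V2"
      and lim: "(\<lambda>n. F1.nrm (fst (\<sigma> n) - x)) \<longlonglongrightarrow> 0" "(\<lambda>n. F2.nrm (snd (\<sigma> n) - y)) \<longlonglongrightarrow> 0"
      using assms(3)[unfolded F1.hilbert_on_iff, rule_format, of "\<lambda>n. fst (\<sigma> n)"]
        assms(4)[unfolded F2.hilbert_on_iff, rule_format, of "\<lambda>n. snd (\<sigma> n)"] by auto
    have "(\<lambda>n. sqrt ((F1.nrm (fst (\<sigma> n) - x))\<^sup>2 + (F2.nrm (snd (\<sigma> n) - y))\<^sup>2)) \<longlonglongrightarrow> sqrt (0\<^sup>2 + 0\<^sup>2)"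
      by (intro tendsto_intros lim)
    moreover have "\<sigma> n - (x, y) \<in> V1 \<times> V2" for n
      using F.subspace_diff[OF F.subspace] in_V xy by blast
    ultimately have "(\<lambda>n. F.nrm (\<sigma> n - (x, y))) \<longlonglongrightarrow> 0"
      by (simp add: nrm)
    thus "\<exists>l\<in>V1 \<times> V2. (\<lambda>n. F.nrm (\<sigma> n - l)) \<longlonglongrightarrow> 0" using xy by blast
  qed
qed

text \<open>
  Componentwise positive and negative parts; a sum of Hilbert spaces is complete.
\<close>

lemma krein_space_orth_sum:
  assumes "krein_space X" "krein_space Y"
  shows "krein_space (orth_sum X Y)"
proof -
  interpret X: krein X by unfold_locales (rule assms)
  interpret Y: krein Y by unfold_locales (rule assms)
  let ?s = "\<lambda>c u. (scl X c (fst u), scl Y c (snd u))"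
  interpret P: positive_form ?s "\<lambda>u v. ip X (fst u) (fst v) + ip Y (snd u) (snd v)" "X.Vp \<times> Y.Vp"
    by (rule positive_form_Times) (rule X.pos.positive_form_axioms Y.pos.positive_form_axioms)+
  interpret N: positive_form ?s "\<lambda>u v. - ip X (fst u) (fst v) + - ip Y (snd u) (snd v)" "X.Vn \<times> Y.Vn"
    by (rule positive_form_Times) (rule X.neg.positive_form_axioms Y.neg.positive_form_axioms)+
  have "hermitian_space (orth_sum X Y)"
    by (rule hermitian_spaceI) (simp add: orth_sum_def P.hermitian_form_axioms)
  moreover have "fundamental_decomposition (orth_sum X Y) (X.Vp \<times> Y.Vp) (X.Vn \<times> Y.Vn)"
    unfolding fundamental_decomposition_def
  proof (intro conjI ballI allI)
    show "module.subspace (scl (orth_sum X Y)) (X.Vp \<times> Y.Vp)"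
      using P.subspace by (simp add: orth_sum_def)
    show "module.subspace (scl (orth_sum X Y)) (X.Vn \<times> Y.Vn)"
      using N.subspace by (simp add: orth_sum_def)
    show "ip (orth_sum X Y) p n = 0" if "p \<in> X.Vp \<times> Y.Vp" "n \<in> X.Vn \<times> Y.Vn" for p n
      using that by (auto simp: X.orthogonal Y.orthogonal)
    show "(X.Vp \<times> Y.Vp) \<inter> (X.Vn \<times> Y.Vn) = {0}"
      using X.Vp_Vn Y.Vp_Vn by (simp add: Times_Int_Times zero_prod_def)
    show "\<exists>p\<in>X.Vp \<times> Y.Vp. \<exists>n\<in>X.Vn \<times> Y.Vn. u = p + n" for u
    proof (intro bexI)
      show "u = (X.pp (fst u), Y.pp (snd u)) + (X.np (fst u), Y.np (snd u))"
        by (simp add: X.pp_np Y.pp_np)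
    qed auto
    show "hilbert_on (ip (orth_sum X Y)) (X.Vp \<times> Y.Vp)"
      using hilbert_on_Times[OF X.pos.positive_form_axioms Y.pos.positive_form_axioms X.Vp_hilbert Y.Vp_hilbert]
      by (simp add: orth_sum_def)
    show "hilbert_on (\<lambda>x y. - ip (orth_sum X Y) x y) (X.Vn \<times> Y.Vn)"
      using hilbert_on_Times[OF X.neg.positive_form_axioms Y.neg.positive_form_axioms X.Vn_hilbert Y.Vn_hilbert]
      by (simp add: orth_sum_def)
  qed
  ultimately show ?thesis unfolding krein_space_def by blast
qed

definition rel_orth_sum :: "'a rel \<Rightarrow> 'b rel \<Rightarrow> ('a \<times> 'b) rel" where
  "rel_orth_sum A B = {((f, g), (f', g')) | f g f' g'. (f, f') \<in> A \<and> (g, g') \<in> B}"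

lemma in_rel_orth_sum [simp]: "((f, g), (f', g')) \<in> rel_orth_sum A B \<longleftrightarrow> (f, f') \<in> A \<and> (g, g') \<in> B"
  by (auto simp: rel_orth_sum_def)

lemma selfadjoint_rel_orth_sum:
  assumes "krein_space X" "krein_space Y"
    and A: "selfadjoint_relation X A" and B: "selfadjoint_relation Y B"
  shows "selfadjoint_relation (orth_sum X Y) (rel_orth_sum A B)"
proof -
  interpret X: krein X by unfold_locales (rule assms)
  interpret Y: krein Y by unfold_locales (rule assms)
  interpret K: krein "orth_sum X Y" by unfold_locales (rule krein_space_orth_sum[OF assms(1,2)])
  have zero: "(0, 0) \<in> A" "(0, 0) \<in> B"
    using A B by (simp_all add: selfadjoint_relation_def X.linear_relation_iff Y.linear_relation_iff zero_prod_def)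
  have "((f, g), (f', g')) \<in> rel_orth_sum A B \<longleftrightarrow> ((f, g), (f', g')) \<in> rel_adjoint (orth_sum X Y) (rel_orth_sum A B)"
    for f g f' g'
  proof
    assume "((f, g), (f', g')) \<in> rel_orth_sum A B"
    thus "((f, g), (f', g')) \<in> rel_adjoint (orth_sum X Y) (rel_orth_sum A B)"
      using X.selfadjoint_iff[OF A, of f f'] Y.selfadjoint_iff[OF B, of g g']
      by (auto simp: K.rel_adjoint_iff)
  next
    assume adj: "((f, g), (f', g')) \<in> rel_adjoint (orth_sum X Y) (rel_orth_sum A B)"
    have "ip X f h' = ip X f' h" if "(h, h') \<in> A" for h h'
      using adj[unfolded K.rel_adjoint_iff, rule_format, of "(h, 0)" "(h', 0)"] that zero by simp
    moreover have "ip Y g h' = ip Y g' h" if "(h, h') \<in> B" for h h'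
      using adj[unfolded K.rel_adjoint_iff, rule_format, of "(0, h)" "(0, h')"] that zero by simp
    ultimately show "((f, g), (f', g')) \<in> rel_orth_sum A B"
      using X.selfadjoint_iff[OF A, of f f'] Y.selfadjoint_iff[OF B, of g g'] by simp
  qed
  hence eq: "rel_orth_sum A B = rel_adjoint (orth_sum X Y) (rel_orth_sum A B)" by auto
  thus ?thesis
    unfolding selfadjoint_relation_def using K.linear_relation_rel_adjoint[of "rel_orth_sum A B"] by simp
qed

lemma
  assumes "krein_space X" "krein_space Y"
    and A: "selfadjoint_relation X A" and B: "selfadjoint_relation Y B"
    and zA: "z \<in> resolvent_set X A" and zB: "z \<in> resolvent_set Y B"
  shows resolvent_set_orth_sum: "z \<in> resolvent_set (orth_sum X Y) (rel_orth_sum A B)"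
    and resolvent_op_orth_sum: "resolvent_op (orth_sum X Y) (rel_orth_sum A B) z =
      map_prod (resolvent_op X A z) (resolvent_op Y B z)"
proof -
  interpret X: krein X by unfold_locales (rule assms)
  interpret Y: krein Y by unfold_locales (rule assms)
  interpret K: krein "orth_sum X Y" by unfold_locales (rule krein_space_orth_sum[OF assms(1,2)])
  have bounded: "map_prod (resolvent_op X A z) (resolvent_op Y B z) \<in> bounded_ops (orth_sum X Y) (orth_sum X Y)"
  proof (rule K.bounded_if_adjoint)
    show "ip (orth_sum X Y) (map_prod (resolvent_op X A z) (resolvent_op Y B z) u) v =
      ip (orth_sum X Y) u (map_prod (resolvent_op X A (cnj z)) (resolvent_op Y B (cnj z)) v)" for u v
      using X.resolvent_adjoint[OF A zA] Y.resolvent_adjoint[OF B zB] by (cases u; cases v) simp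
  qed
  have graph: "(f, f') \<in> rel_orth_sum A B \<longleftrightarrow>
      f = map_prod (resolvent_op X A z) (resolvent_op Y B z) (f' - scl (orth_sum X Y) z f)" for f f'
    using X.resolvent_iff[OF zA] Y.resolvent_iff[OF zB] by (cases f; cases f') simp
  show "z \<in> resolvent_set (orth_sum X Y) (rel_orth_sum A B)"
    "resolvent_op (orth_sum X Y) (rel_orth_sum A B) z = map_prod (resolvent_op X A z) (resolvent_op Y B z)"
    using K.resolvent_setI[OF bounded graph] by blast+
qed

context krein
begin

lemma selfadjoint_zero_operator: "selfadjoint_relation X (UNIV \<times> {0})"
proof -
  have "rel_adjoint X (UNIV \<times> {0}) = UNIV \<times> {0}"
    using nondegenerate by (auto simp: rel_adjoint_iff)
  thus ?thesis
    unfolding selfadjoint_relation_def using linear_relation_rel_adjoint[of "UNIV \<times> {0}"] by simp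
qed

lemma
  assumes "z \<noteq> 0"
  shows resolvent_set_zero_operator: "z \<in> resolvent_set X (UNIV \<times> {0})"
    and resolvent_op_zero_operator: "resolvent_op X (UNIV \<times> {0}) z = scl X (- inverse z)"
proof -
  have bounded: "scl X (- inverse z) \<in> bounded_ops X X"
    by (rule bounded_if_adjoint[of _ "scl X (cnj (- inverse z))"]) (simp add: form_simps del: scale_minus_left)
  have graph: "(f, f') \<in> UNIV \<times> {0} \<longleftrightarrow> f = scl X (- inverse z) (f' - scl X z f)" for f f'
    using assms by (auto simp: scale_right_diff_distrib)
  show "z \<in> resolvent_set X (UNIV \<times> {0})"
    "resolvent_op X (UNIV \<times> {0}) z = scl X (- inverse z)"
    using resolvent_setI[OF bounded graph] by blast+
qed

end

section \<open>Boundary triples from an injective operator with closed range\<close>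

text \<open>
  A selfadjoint relation \<open>A\<close> and an operator \<open>g\<close> that plays the part of the \<open>\<gamma>\<close>-field at the point \<open>z\<^sub>0\<close>;
  \<open>g'\<close> is its adjoint, \<open>e\<close> a left inverse, and \<open>C\<close> the prescribed value of the Weyl function at \<open>z\<^sub>0\<close>.
  The assumption \<open>range_g\<close> says that the range of \<open>g\<close> is its own double orthogonal complement. With it
  the relation \<open>T\<close> below is closed and equals its double adjoint by an algebraic computation, without
  a separation theorem. The identity \<open>C_form\<close> is the one that every Weyl function satisfies at \<open>z\<^sub>0\<close>.
\<close>

locale gamma_map = K: krein K + G: krein G
  for K :: "'k::ab_group_add ip_space" and G :: "'g::ab_group_add ip_space" +
  fixes A :: "'k rel" and z\<^sub>0 :: complex and g :: "'g \<Rightarrow> 'k" and g' :: "'k \<Rightarrow> 'g" and e :: "'k \<Rightarrow> 'g"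
    and C :: "'g \<Rightarrow> 'g"
  assumes hilbert: "hilbert_space G"
    and selfadjoint: "selfadjoint_relation K A"
    and z\<^sub>0: "z\<^sub>0 \<in> resolvent_set K A"
    and g: "Vector_Spaces.linear (scl G) (scl K) g"
    and adjoint: "ip K (g x) k = ip G x (g' k)"
    and e: "Vector_Spaces.linear (scl K) (scl G) e"
    and e_g [simp]: "e (g x) = x"
    and range_g: "(\<And>k. g' k = 0 \<Longrightarrow> ip K k u = 0) \<Longrightarrow> u \<in> range g"
    and C: "Vector_Spaces.linear (scl G) (scl G) C"
    and C_form: "ip G (C x) y - ip G x (C y) = (z\<^sub>0 - cnj z\<^sub>0) * ip K (g x) (g y)"
begin

interpretation g: Vector_Spaces.linear "scl G" "scl K" g by (rule g)
interpretation e: Vector_Spaces.linear "scl K" "scl G" e by (rule e)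
interpretation C: Vector_Spaces.linear "scl G" "scl G" C by (rule C)

definition R :: "'k \<Rightarrow> 'k" where "R = resolvent_op K A z\<^sub>0"

lemma R_bounded: "R \<in> bounded_ops K K"
  unfolding R_def by (rule K.resolvent_bounded[OF z\<^sub>0])

interpretation R: Vector_Spaces.linear "scl K" "scl K" R
  using R_bounded by (simp add: bounded_ops_def)

lemma adjoint': "ip K k (g x) = ip G (g' k) x"
  using adjoint[of x k] K.commute[of "g x" k] G.commute[of x "g' k"] by simp

lemma g'_linear: "Vector_Spaces.linear (scl K) (scl G) g'"
  by unfold_locales (rule G.ip_eqI; simp add: K.form_simps G.form_simps flip: adjoint')+

interpretation g': Vector_Spaces.linear "scl K" "scl G" g' by (rule g'_linear)

text \<open>
  The relation \<open>A + {(g x, z\<^sub>0 g x)}\<close>. For an element \<open>(f, f')\<close> with components \<open>(f\<^sub>0, f\<^sub>0')\<close> in \<open>A\<close> and \<open>x\<close> one has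
  \<open>f' - z\<^sub>0 f = f\<^sub>0' - z\<^sub>0 f\<^sub>0\<close>, so \<open>R (f' - z\<^sub>0 f) = f\<^sub>0\<close> and \<open>f - R (f' - z\<^sub>0 f) = g x\<close>. This makes the components
  linear in \<open>(f, f')\<close>: the boundary values are \<open>\<Gamma>\<^sub>0 = x\<close> and \<open>\<Gamma>\<^sub>1 = g' (f\<^sub>0' - cnj z\<^sub>0 f\<^sub>0) + C x\<close>.
\<close>

definition T :: "'k rel" where
  "T = {(f, f'). f - R (f' - scl K z\<^sub>0 f) \<in> range g}"

definition \<Gamma>\<^sub>0 :: "'k \<times> 'k \<Rightarrow> 'g" where
  "\<Gamma>\<^sub>0 = (\<lambda>(f, f'). e (f - R (f' - scl K z\<^sub>0 f)))"

definition \<Gamma>\<^sub>1 :: "'k \<times> 'k \<Rightarrow> 'g" where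
  "\<Gamma>\<^sub>1 = (\<lambda>(f, f'). g' ((f' - scl K z\<^sub>0 f) + scl K (z\<^sub>0 - cnj z\<^sub>0) (R (f' - scl K z\<^sub>0 f)))
    + C (\<Gamma>\<^sub>0 (f, f')))"

text \<open>
  The parametrisation of \<open>T\<close> by \<open>k = f' - z\<^sub>0 f\<close> and \<open>x\<close>.
\<close>

definition elt :: "'k \<Rightarrow> 'g \<Rightarrow> 'k \<times> 'k" where
  "elt k x = (R k + g x, k + scl K z\<^sub>0 (R k + g x))"

lemma T_eq: "T = {elt k x | k x. True}"
proof (intro set_eqI iffI)
  fix u assume "u \<in> T"
  then obtain f f' x where u: "u = (f, f')" and x: "f - R (f' - scl K z\<^sub>0 f) = g x"
    by (auto simp: T_def)
  have "u = elt (f' - scl K z\<^sub>0 f) x"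
    by (simp add: u elt_def flip: x)
  thus "u \<in> {elt k x | k x. True}" by blast
qed (auto simp: T_def elt_def)

lemma \<Gamma>\<^sub>0_elt [simp]: "\<Gamma>\<^sub>0 (elt k x) = x"
  by (simp add: \<Gamma>\<^sub>0_def elt_def)

lemma \<Gamma>\<^sub>1_elt: "\<Gamma>\<^sub>1 (elt k x) = g' (k + scl K (z\<^sub>0 - cnj z\<^sub>0) (R k)) + C x"
  using \<Gamma>\<^sub>0_elt[of k x] by (simp add: \<Gamma>\<^sub>1_def elt_def)

lemma elt_in_A: "elt k 0 \<in> A"
  using K.resolvent_in[OF z\<^sub>0] by (simp add: elt_def R_def)

lemma A_elt:
  assumes "(f, f') \<in> A"
  shows "(f, f') = elt (f' - scl K z\<^sub>0 f) 0"
  using assms K.resolvent_iff[OF z\<^sub>0, of f f'] by (simp add: elt_def R_def)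

lemma A_subset_T: "A \<subseteq> T"
  unfolding T_eq by (clarify, blast dest: A_elt)

lemma kernel: "boundary_kernel T \<Gamma>\<^sub>0 = A"
proof (intro set_eqI iffI)
  fix u assume "u \<in> boundary_kernel T \<Gamma>\<^sub>0"
  then obtain k x where "u = elt k x" "\<Gamma>\<^sub>0 u = 0" by (auto simp: boundary_kernel_def T_eq)
  thus "u \<in> A" using elt_in_A by simp
next
  fix u assume u: "u \<in> A"
  then obtain k where "u = elt k 0" using A_elt by (cases u) blast
  thus "u \<in> boundary_kernel T \<Gamma>\<^sub>0" using u A_subset_T by (auto simp: boundary_kernel_def)
qed

lemma linear_T: "linear_relation K T"
  unfolding K.linear_relation_iff
proof (intro conjI ballI allI)
  show "0 \<in> T" by (auto simp: T_def zero_prod_def intro: range_eqI[of _ _ 0])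
  show "u + v \<in> T" if uv: "u \<in> T" "v \<in> T" for u v
  proof -
    obtain k x l y where "u = elt k x" "v = elt l y" using uv by (auto simp: T_eq)
    hence "u + v = elt (k + l) (x + y)"
      by (simp add: elt_def R.add g.add algebra_simps)
    thus ?thesis unfolding T_eq by blast
  qed
  show "scl2 K c u \<in> T" if u: "u \<in> T" for c u
  proof -
    obtain k x where "u = elt k x" using u by (auto simp: T_eq)
    hence "scl2 K c u = elt (scl K c k) (scl G c x)"
      by (simp add: elt_def scl2_def R.scale g.scale algebra_simps)
    thus ?thesis unfolding T_eq by blast
  qed
qed

lemma \<Gamma>\<^sub>0_add: "\<Gamma>\<^sub>0 (f + h, f' + h') = \<Gamma>\<^sub>0 (f, f') + \<Gamma>\<^sub>0 (h, h')"
  and \<Gamma>\<^sub>0_scale: "\<Gamma>\<^sub>0 (scl K c f, scl K c f') = scl G c (\<Gamma>\<^sub>0 (f, f'))"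
  by (simp_all add: \<Gamma>\<^sub>0_def R.add R.diff R.scale e.add e.diff e.scale algebra_simps)

lemma linear_\<Gamma>\<^sub>0: "linear_on_relation K G T \<Gamma>\<^sub>0"
  by (auto simp: linear_on_relation_def scl2_def \<Gamma>\<^sub>0_add \<Gamma>\<^sub>0_scale)

lemma \<Gamma>\<^sub>1_add: "\<Gamma>\<^sub>1 (f + h, f' + h') = \<Gamma>\<^sub>1 (f, f') + \<Gamma>\<^sub>1 (h, h')"
proof -
  have "f' + h' - scl K z\<^sub>0 (f + h) = (f' - scl K z\<^sub>0 f) + (h' - scl K z\<^sub>0 h)"
    by (simp add: K.scale_right_distrib)
  thus ?thesis
    unfolding \<Gamma>\<^sub>1_def prod.case \<Gamma>\<^sub>0_add
    by (simp only: R.add g'.add C.add K.scale_right_distrib add_ac)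
qed

lemma \<Gamma>\<^sub>1_scale: "\<Gamma>\<^sub>1 (scl K c f, scl K c f') = scl G c (\<Gamma>\<^sub>1 (f, f'))"
proof -
  have "scl K c f' - scl K z\<^sub>0 (scl K c f) = scl K c (f' - scl K z\<^sub>0 f)"
    by (simp add: K.scale_right_diff_distrib mult.commute)
  thus ?thesis
    unfolding \<Gamma>\<^sub>1_def prod.case \<Gamma>\<^sub>0_scale
    by (simp only: R.scale g'.scale C.scale g'.add K.scale_right_distrib G.scale_right_distrib
        K.scale_left_commute[of _ c])
qed

lemma linear_\<Gamma>\<^sub>1: "linear_on_relation K G T \<Gamma>\<^sub>1"
  by (auto simp: linear_on_relation_def scl2_def \<Gamma>\<^sub>1_add \<Gamma>\<^sub>1_scale)

text \<open>
  On \<open>A\<close> both sides vanish, the mixed terms agree by adjointness of \<open>g\<close> and \<open>g'\<close>, and the terms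
  in \<open>x\<close> and \<open>y\<close> alone agree by \<open>C_form\<close>.
\<close>

lemma Green: "ip2 K (elt k x) (elt l y) = ip2 G (\<Gamma>\<^sub>0 (elt k x), \<Gamma>\<^sub>1 (elt k x)) (\<Gamma>\<^sub>0 (elt l y), \<Gamma>\<^sub>1 (elt l y))"
proof -
  have A: "ip K (R k) (l + scl K z\<^sub>0 (R l)) = ip K (k + scl K z\<^sub>0 (R k)) (R l)"
    using K.selfadjointD[OF selfadjoint] elt_in_A[of k] elt_in_A[of l] by (simp add: elt_def)
  have "ip G x (\<Gamma>\<^sub>1 (elt l y)) - ip G (\<Gamma>\<^sub>1 (elt k x)) y
    = ip K (g x) (l + scl K (z\<^sub>0 - cnj z\<^sub>0) (R l)) - ip K (k + scl K (z\<^sub>0 - cnj z\<^sub>0) (R k)) (g y)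
      - (z\<^sub>0 - cnj z\<^sub>0) * ip K (g x) (g y)"
    by (simp add: \<Gamma>\<^sub>1_elt G.form_simps flip: adjoint adjoint' C_form)
  moreover have "ip K (R k + g x) (l + scl K z\<^sub>0 (R l + g y)) - ip K (k + scl K z\<^sub>0 (R k + g x)) (R l + g y)
    = ip K (g x) (l + scl K (z\<^sub>0 - cnj z\<^sub>0) (R l)) - ip K (k + scl K (z\<^sub>0 - cnj z\<^sub>0) (R k)) (g y)
      - (z\<^sub>0 - cnj z\<^sub>0) * ip K (g x) (g y)"
    using A by (simp add: K.form_simps algebra_simps)
  ultimately show ?thesis
    by (simp add: ip2_def elt_def[of k x] elt_def[of l y]) (simp flip: elt_def)
qed

abbreviation "S \<equiv> rel_adjoint K T"

lemma S_iff: "(f, f') \<in> S \<longleftrightarrow> (f, f') \<in> A \<and> g' (f' - scl K (cnj z\<^sub>0) f) = 0"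
proof
  assume f: "(f, f') \<in> S"
  have "S \<subseteq> rel_adjoint K A" by (rule K.rel_adjoint_antimono[OF A_subset_T])
  hence "(f, f') \<in> A" using f selfadjoint by (auto simp: selfadjoint_relation_def)
  moreover have "g' (f' - scl K (cnj z\<^sub>0) f) = 0"
  proof (rule G.nondegenerate)
    fix x
    have "elt 0 x \<in> T" unfolding T_eq by blast
    hence "(g x, scl K z\<^sub>0 (g x)) \<in> T" by (simp add: elt_def)
    hence "ip K f (scl K z\<^sub>0 (g x)) = ip K f' (g x)" using f unfolding K.rel_adjoint_iff by blast
    thus "ip G (g' (f' - scl K (cnj z\<^sub>0) f)) x = 0"
      by (simp add: K.form_simps flip: adjoint')
  qed
  ultimately show "(f, f') \<in> A \<and> g' (f' - scl K (cnj z\<^sub>0) f) = 0" ..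
next
  assume f: "(f, f') \<in> A \<and> g' (f' - scl K (cnj z\<^sub>0) f) = 0"
  show "(f, f') \<in> S"
    unfolding K.rel_adjoint_iff
  proof (intro allI impI)
    fix h h' assume "(h, h') \<in> T"
    then obtain k x where h: "h = R k + g x" "h' = k + scl K z\<^sub>0 (R k + g x)"
      by (auto simp: T_eq elt_def)
    have "ip K f (k + scl K z\<^sub>0 (R k)) = ip K f' (R k)"
      using f K.selfadjointD[OF selfadjoint, of f f'] elt_in_A[of k] by (simp add: elt_def)
    moreover have "ip K (f' - scl K (cnj z\<^sub>0) f) (g x) = 0"
      using f by (simp add: adjoint')
    ultimately show "ip K f h' = ip K f' h"
      by (simp add: h K.form_simps algebra_simps)
  qed
qed

text \<open>
  The resolvent at \<open>cnj z\<^sub>0\<close> supplies an element of \<open>S\<close> for every \<open>k\<close> in the kernel of \<open>g'\<close>. Orthogonality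
  of \<open>(f, f')\<close> to these elements says that \<open>f - R (f' - z\<^sub>0 f)\<close> is orthogonal to that kernel, hence lies in
  the range of \<open>g\<close>.
\<close>

lemma T_eq_rel_adjoint_S: "T = rel_adjoint K S"
proof
  have "ip2 K u v = 0" if "ip2 K v u = 0" for u v
    using that K.commute[of "fst v" "snd u"] K.commute[of "snd v" "fst u"]
    by (cases u; cases v) (simp add: ip2_def)
  thus "T \<subseteq> rel_adjoint K S" by (auto simp: rel_adjoint_def)
next
  show "rel_adjoint K S \<subseteq> T"
  proof
    fix p assume p: "p \<in> rel_adjoint K S"
    obtain f f' where pf: "p = (f, f')" by (cases p)
    define R' where "R' = resolvent_op K A (cnj z\<^sub>0)"
    have z: "cnj z\<^sub>0 \<in> resolvent_set K A"
      by (rule K.selfadjoint_resolvent_cnj[OF selfadjoint z\<^sub>0])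
    have "f - R (f' - scl K z\<^sub>0 f) \<in> range g"
    proof (rule range_g)
      fix k assume k: "g' k = 0"
      have adj: "ip K (R' k) u = ip K k (R u)" for u
        using K.resolvent_adjoint[OF selfadjoint z] by (simp add: R'_def R_def)
      have "(R' k, k + scl K (cnj z\<^sub>0) (R' k)) \<in> S"
        unfolding S_iff using K.resolvent_in[OF z, of k] k by (simp add: R'_def)
      hence "ip K f (k + scl K (cnj z\<^sub>0) (R' k)) = ip K f' (R' k)"
        using p unfolding pf K.rel_adjoint_iff by blast
      hence "ip K (k + scl K (cnj z\<^sub>0) (R' k)) f = ip K (R' k) f'"
        by (metis K.commute)
      thus "ip K k (f - R (f' - scl K z\<^sub>0 f)) = 0"
        by (simp add: K.form_simps R.diff R.scale adj algebra_simps)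
    qed
    thus "p \<in> T" by (simp add: T_def pf)
  qed
qed

lemma symmetric_S: "symmetric_relation K S"
proof -
  have "S \<subseteq> A" using S_iff by auto
  hence "S \<subseteq> rel_adjoint K S" using A_subset_T T_eq_rel_adjoint_S by simp
  thus ?thesis by (simp add: symmetric_relation_def K.linear_relation_rel_adjoint)
qed

lemma boundary_triple: "generalized_boundary_triple K S T G \<Gamma>\<^sub>0 \<Gamma>\<^sub>1"
  unfolding generalized_boundary_triple_def kernel
proof (intro conjI ballI)
  have "closedin (topology2 K) T"
    using K.closedin_rel_adjoint[of S] by (simp flip: T_eq_rel_adjoint_S)
  thus "topology2 K closure_of T = rel_adjoint K S"
    by (simp add: closure_of_closedin flip: T_eq_rel_adjoint_S)
  show "ip2 K u v = ip2 G (\<Gamma>\<^sub>0 u, \<Gamma>\<^sub>1 u) (\<Gamma>\<^sub>0 v, \<Gamma>\<^sub>1 v)" if "u \<in> T" "v \<in> T" for u v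
    using that by (auto simp: T_eq Green)
  show "\<Gamma>\<^sub>0 ` T = UNIV"
  proof -
    have "elt 0 x \<in> T" for x unfolding T_eq by blast
    thus ?thesis by (metis \<Gamma>\<^sub>0_elt image_eqI UNIV_eq_I)
  qed
qed (rule linear_T hilbert linear_\<Gamma>\<^sub>0 linear_\<Gamma>\<^sub>1 selfadjoint)+

text \<open>
  The defect element at \<open>z\<close> with first boundary value \<open>x\<close> is
  \<open>f = g x + (z - z\<^sub>0) r\<close> with \<open>r\<close> the image of \<open>g x\<close> under the resolvent at \<open>z\<close>. Since
  \<open>(r, g x + z r) = (r, f + z\<^sub>0 r)\<close> belongs to \<open>A\<close>, also \<open>R f = r\<close>, which is all that is needed
  to evaluate the second boundary value.
\<close>

lemma weyl_function:
  assumes z: "z \<in> resolvent_set K A"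
  shows "weyl_function K T \<Gamma>\<^sub>0 \<Gamma>\<^sub>1 z x = C x + g' (scl K (z - z\<^sub>0) (g x)
    + scl K ((z - z\<^sub>0) * (z - cnj z\<^sub>0)) (resolvent_op K A z (g x)))"
proof -
  define r where "r = resolvent_op K A z (g x)"
  define f where "f = g x + scl K (z - z\<^sub>0) r"
  have "(r, g x + scl K z r) \<in> A"
    unfolding r_def by (rule K.resolvent_in[OF z])
  hence "R f = r"
    using K.resolvent_iff[OF z\<^sub>0, of r "g x + scl K z r"] by (simp add: R_def f_def algebra_simps)
  hence Rk: "R (scl K (z - z\<^sub>0) f) = scl K (z - z\<^sub>0) r"
    by (simp add: R.scale)
  have f: "(f, scl K z f) = elt (scl K (z - z\<^sub>0) f) x"
    unfolding elt_def Rk by (simp add: f_def algebra_simps)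
  have "inv_into (defect_relation K T z) \<Gamma>\<^sub>0 x = (f, scl K z f)"
  proof (rule inv_into_f_eq)
    show "(f, scl K z f) \<in> defect_relation K T z"
      using f unfolding defect_relation_def T_eq by blast
    show "\<Gamma>\<^sub>0 (f, scl K z f) = x" by (simp add: f)
    show "inj_on \<Gamma>\<^sub>0 (defect_relation K T z)"
    proof (rule inj_onI)
      fix u v assume uv: "u \<in> defect_relation K T z" "v \<in> defect_relation K T z" "\<Gamma>\<^sub>0 u = \<Gamma>\<^sub>0 v"
      then obtain a b where ab: "u = (a, scl K z a)" "v = (b, scl K z b)" "u \<in> T" "v \<in> T"
        by (auto simp: defect_relation_def)
      have "u - v \<in> T" by (rule K.linear_relation_diff[OF linear_T ab(3,4)])
      moreover have "\<Gamma>\<^sub>0 (u - v) = 0"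
        using \<Gamma>\<^sub>0_add[of "a - b" b "scl K z a - scl K z b" "scl K z b"] uv(3) by (simp add: ab)
      ultimately have "u - v \<in> boundary_kernel T \<Gamma>\<^sub>0"
        by (simp add: boundary_kernel_def)
      hence "(a - b, scl K z (a - b)) \<in> A"
        unfolding kernel by (simp add: ab K.scale_right_diff_distrib)
      hence "a - b = 0"
        using K.resolvent_iff[OF z, of "a - b" "scl K z (a - b)"] K.resolvent_zero[OF z] by simp
      thus "u = v" by (simp add: ab)
    qed
  qed
  hence "weyl_function K T \<Gamma>\<^sub>0 \<Gamma>\<^sub>1 z x = \<Gamma>\<^sub>1 (elt (scl K (z - z\<^sub>0) f) x)"
    by (simp add: weyl_function_def f)
  also have "\<dots> = g' (scl K (z - z\<^sub>0) f + scl K (z\<^sub>0 - cnj z\<^sub>0) (scl K (z - z\<^sub>0) r)) + C x"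
    by (simp add: \<Gamma>\<^sub>1_elt Rk)
  also have "scl K (z - z\<^sub>0) f + scl K (z\<^sub>0 - cnj z\<^sub>0) (scl K (z - z\<^sub>0) r)
    = scl K (z - z\<^sub>0) (g x) + scl K ((z - z\<^sub>0) * (z - cnj z\<^sub>0)) r"
    by (simp add: f_def algebra_simps flip: K.scale_left_distrib)
  finally show ?thesis by (simp add: r_def add.commute)
qed

end

section \<open>Realisation of operator functions\<close>

lemma linear_krein_spacesI:
  assumes "krein_space X" "krein_space Y" "\<And>x y. f (x + y) = f x + f y" "\<And>c x. f (scl X c x) = scl Y c (f x)"
  shows "Vector_Spaces.linear (scl X) (scl Y) f"
proof -
  interpret X: krein X by unfold_locales (rule assms)
  interpret Y: krein Y by unfold_locales (rule assms)
  show ?thesis by unfold_locales (rule assms)+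
qed

text \<open>
  A vector of the multivalued part of \<open>A\<^sub>0\<close> is annihilated by every resolvent. If the adjoint of \<open>\<gamma>\<close>
  annihilates it too, it is orthogonal to all vectors whose span is dense by minimality. This is what
  makes the symmetric relation of the boundary triple an operator.
\<close>

lemma minimal_multivalued_part:
  assumes min: "minimal_representation G D \<tau> H A\<^sub>0 \<gamma> \<O> z\<^sub>0"
    and G: "krein_space G"
    and h: "(0, h) \<in> A\<^sub>0" and zero: "op_adjoint G H \<gamma> h = 0"
  shows "h = 0"
proof -
  have H: "krein_space H" and A: "selfadjoint_relation H A\<^sub>0" and \<gamma>: "\<gamma> \<in> bounded_ops G H"
    and \<O>: "\<O> \<subseteq> resolvent_set H A\<^sub>0"
    and dense: "kp_topology H closure_of module.span (scl H)
      {\<gamma> x + scl H (z - z\<^sub>0) (resolvent_op H A\<^sub>0 z (\<gamma> x)) | z x. z \<in> \<O> \<union> cnj -` \<O>} = UNIV"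
    using min unfolding minimal_representation_def by blast+
  interpret H: krein H by unfold_locales (rule H)
  interpret G: krein G by unfold_locales (rule G)
  from dense show ?thesis
  proof (rule H.orthogonal_dense)
    fix u assume "u \<in> {\<gamma> x + scl H (z - z\<^sub>0) (resolvent_op H A\<^sub>0 z (\<gamma> x)) | z x. z \<in> \<O> \<union> cnj -` \<O>}"
    then obtain z x where z: "z \<in> \<O> \<union> cnj -` \<O>"
      and u: "u = \<gamma> x + scl H (z - z\<^sub>0) (resolvent_op H A\<^sub>0 z (\<gamma> x))" by blast
    have "z \<in> resolvent_set H A\<^sub>0"
      using z \<O> H.selfadjoint_resolvent_cnj[OF A, of "cnj z"] by auto
    from H.selfadjointD[OF A H.resolvent_in[OF this] h]
    have "ip H (resolvent_op H A\<^sub>0 z (\<gamma> x)) h = 0" by simp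
    moreover have "ip H (\<gamma> x) h = 0"
      using op_adjoint[OF G H \<gamma>] zero by simp
    ultimately show "ip H u h = 0" by (simp add: u H.form_simps)
  qed
qed

theorem theorem3p1:
  fixes G :: "'g::ab_group_add ip_space"
    and D :: "complex set"
    and \<tau> :: "complex \<Rightarrow> 'g \<Rightarrow> 'g"
    and H :: "'h::ab_group_add ip_space"
    and A\<^sub>0 :: "'h rel"
    and \<gamma> :: "'g \<Rightarrow> 'h"
    and \<O> :: "complex set"
    and z\<^sub>0 :: complex
  assumes "hilbert_space G"
    and "D \<subseteq> {z. Im z > 0}" and "open D" and "simply_connected D"
    and "\<And>z. z \<in> D \<union> cnj -` D \<Longrightarrow> \<tau> z \<in> bounded_ops G G"
    and "op_meromorphic_on G \<tau> (D \<union> cnj -` D)"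
    and "minimal_representation G D \<tau> H A\<^sub>0 \<gamma> \<O> z\<^sub>0"
  shows "\<exists>(K :: ('h \<times> 'g \<times> 'g) ip_space) S T \<Gamma>\<^sub>0 \<Gamma>\<^sub>1.
    krein_space K \<and>
    symmetric_relation K S \<and> closedin (topology2 K) S \<and> single_valued S \<and>
    generalized_boundary_triple K S T G \<Gamma>\<^sub>0 \<Gamma>\<^sub>1 \<and>
    weyl_function_coincides K T \<Gamma>\<^sub>0 \<Gamma>\<^sub>1 \<tau> (\<O> \<union> cnj -` \<O>)"
proof -
  have H: "krein_space H" and A\<^sub>0: "selfadjoint_relation H A\<^sub>0" and \<gamma>: "\<gamma> \<in> bounded_ops G H"
    and \<O>: "\<O> \<subseteq> resolvent_set H A\<^sub>0" "\<O> \<subseteq> D" and z\<^sub>0: "z\<^sub>0 \<in> \<O> \<union> cnj -` \<O>"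
    and rep: "\<And>z x. z \<in> \<O> \<union> cnj -` \<O> \<Longrightarrow> \<tau> z x = op_real_part G (\<tau> z\<^sub>0) x +
          op_adjoint G H \<gamma>
            (scl H (z - complex_of_real (Re z\<^sub>0)) (\<gamma> x) +
             scl H ((z - z\<^sub>0) * (z - cnj z\<^sub>0)) (resolvent_op H A\<^sub>0 z (\<gamma> x)))"
    using assms(7) unfolding minimal_representation_def by blast+
  have G: "krein_space G" by (rule krein_space_hilbert[OF assms(1)])
  define G2 where "G2 = orth_sum G (anti G)"
  define K where "K = orth_sum H G2"
  have G2: "krein_space G2"
    unfolding G2_def by (intro krein_space_orth_sum krein_space_anti G)
  have K: "krein_space K"
    unfolding K_def by (intro krein_space_orth_sum H G2)
  interpret H: krein H by unfold_locales (rule H)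
  interpret G: krein G by unfold_locales (rule G)
  interpret G2: krein G2 by unfold_locales (rule G2)
  interpret K: krein K by unfold_locales (rule K)
  have scl_K: "scl K c (h, a, b) = (scl H c h, scl G c a, scl G c b)" for c h a b
    by (simp add: K_def G2_def)
  have ip_K: "ip K (h, a, b) (h', a', b') = ip H h h' + (ip G a a' - ip G b b')" for h a b h' a' b'
    by (simp add: K_def G2_def)

  \<comment> \<open>The spectrum of the zero operator consists of a real point, so \<open>\<O>\<close> and its reflection
    stay in the resolvent set.\<close>
  define A where "A = rel_orth_sum A\<^sub>0 ((UNIV :: ('g \<times> 'g) set) \<times> {0})"
  have A: "selfadjoint_relation K A"
    unfolding K_def A_def by (rule selfadjoint_rel_orth_sum[OF H G2 A\<^sub>0 G2.selfadjoint_zero_operator])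
  have \<rho>: "z \<in> resolvent_set K A"
    and R: "resolvent_op K A z (h, a, b)
      = (resolvent_op H A\<^sub>0 z h, scl G (- inverse z) a, scl G (- inverse z) b)"
    if z: "z \<in> \<O> \<union> cnj -` \<O>" for z h a b
  proof -
    have z_H: "z \<in> resolvent_set H A\<^sub>0"
      using z \<O> H.selfadjoint_resolvent_cnj[OF A\<^sub>0, of "cnj z"] by auto
    have "Im z \<noteq> 0" using z \<O>(2) assms(2) by fastforce
    hence "z \<noteq> 0" by auto
    note z_G = G2.resolvent_set_zero_operator[OF this] and R_G = G2.resolvent_op_zero_operator[OF this]
    show "z \<in> resolvent_set K A"
      unfolding K_def A_def
      by (rule resolvent_set_orth_sum[OF H G2 A\<^sub>0 G2.selfadjoint_zero_operator z_H z_G])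
    show "resolvent_op K A z (h, a, b)
      = (resolvent_op H A\<^sub>0 z h, scl G (- inverse z) a, scl G (- inverse z) b)"
      unfolding K_def A_def
        resolvent_op_orth_sum[OF H G2 A\<^sub>0 G2.selfadjoint_zero_operator z_H z_G] R_G
      by (simp add: G2_def)
  qed

  define \<gamma>' where "\<gamma>' = op_adjoint G H \<gamma>"
  have adj: "ip H (\<gamma> x) h = ip G x (\<gamma>' h)" for x h
    unfolding \<gamma>'_def by (rule op_adjoint[OF G H \<gamma>])
  have \<gamma>'_add: "\<gamma>' (h + h') = \<gamma>' h + \<gamma>' h'" and \<gamma>'_scale: "\<gamma>' (scl H c h) = scl G c (\<gamma>' h)" for h h' c
    by (rule G.ip_eqI_right; simp add: G.form_simps H.form_simps flip: adj)+
  have \<gamma>_add: "\<gamma> (x + y) = \<gamma> x + \<gamma> y" and \<gamma>_scale: "\<gamma> (scl G c x) = scl H c (\<gamma> x)" for x y c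
    using bounded_opsD[OF \<gamma>] by auto

  \<comment> \<open>The vectors \<open>(x, x)\<close> are neutral and stay so under the resolvent, hence they do not contribute to
    the Weyl function; they make \<open>g\<close> injective with closed range.\<close>
  define g where "g x = (\<gamma> x, x, x)" for x
  define g' where "g' k = \<gamma>' (fst k) + fst (snd k) - snd (snd k)" for k
  have \<tau>\<^sub>0: "\<tau> z\<^sub>0 \<in> bounded_ops G G"
    by (rule assms(5)) (use z\<^sub>0 \<O>(2) in auto)
  define C where "C = op_real_part G (\<tau> z\<^sub>0)"
  have \<tau>_eq: "\<tau> z x = C x + \<gamma>' (scl H (z - complex_of_real (Re z\<^sub>0)) (\<gamma> x) +
             scl H ((z - z\<^sub>0) * (z - cnj z\<^sub>0)) (resolvent_op H A\<^sub>0 z (\<gamma> x)))"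
    if "z \<in> \<O> \<union> cnj -` \<O>" for z x
    using rep[OF that] by (simp add: C_def \<gamma>'_def)
  have \<tau>\<^sub>0_eq: "\<tau> z\<^sub>0 x = C x + scl G (z\<^sub>0 - complex_of_real (Re z\<^sub>0)) (\<gamma>' (\<gamma> x))" for x
    using \<tau>_eq[OF z\<^sub>0, of x] by (simp add: \<gamma>'_scale)
  have C_sym: "ip G (C x) y = ip G x (C y)" for x y
  proof -
    define B where "B = op_adjoint G G (\<tau> z\<^sub>0)"
    have B: "ip G (\<tau> z\<^sub>0 x) y = ip G x (B y)" for x y
      unfolding B_def by (rule op_adjoint[OF G G \<tau>\<^sub>0])
    have "ip G (B x) y = ip G x (\<tau> z\<^sub>0 y)"
      using B[of y x] G.commute[of "B x" y] G.commute[of x "\<tau> z\<^sub>0 y"] by simp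
    thus ?thesis
      by (simp add: C_def op_real_part_def G.form_simps B flip: B_def)
  qed

  interpret gamma_map K G A z\<^sub>0 g g' "\<lambda>k. snd (snd k)" "\<tau> z\<^sub>0"
  proof (intro gamma_map.intro gamma_map_axioms.intro K.krein_axioms G.krein_axioms)
    show "hilbert_space G" "selfadjoint_relation K A" by (rule assms(1), rule A)
    show "z\<^sub>0 \<in> resolvent_set K A" by (rule \<rho>[OF z\<^sub>0])
    show "Vector_Spaces.linear (scl G) (scl K) g"
      by (rule linear_krein_spacesI[OF G K]) (simp_all add: g_def scl_K \<gamma>_add \<gamma>_scale)
    show "Vector_Spaces.linear (scl K) (scl G) (\<lambda>k. snd (snd k))"
      by (rule linear_krein_spacesI[OF K G]) (auto simp: scl_K)
    show "Vector_Spaces.linear (scl G) (scl G) (\<tau> z\<^sub>0)"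
      using \<tau>\<^sub>0 by (simp add: bounded_ops_def)
    show "snd (snd (g x)) = x" for x by (simp add: g_def)
    show "ip K (g x) k = ip G x (g' k)" for x k
      by (cases k) (simp add: g_def g'_def ip_K adj G.form_simps)
    show "u \<in> range g" if u: "\<And>k. g' k = 0 \<Longrightarrow> ip K k u = 0" for u
    proof -
      obtain h a b where u_eq: "u = (h, a, b)" by (cases u)
      \<comment> \<open>The triples \<open>(k, c, \<gamma>' k + c)\<close> form the kernel of \<open>g'\<close>.\<close>
      have eq: "ip H k h + (ip G c a - ip G (\<gamma>' k + c) b) = 0" for k c
        using u[of "(k, c, \<gamma>' k + c)"] by (simp add: u_eq g'_def ip_K)
      have "\<gamma>' 0 = 0" using \<gamma>'_add[of 0 0] by simp
      hence "a = b" using eq[of 0] by (intro G.ip_eqI_right) simp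
      moreover have "h = \<gamma> b"
      proof (rule H.ip_eqI_right)
        fix k
        have "ip H k (\<gamma> b) = ip G (\<gamma>' k) b"
          using adj[of b k] H.commute[of "\<gamma> b" k] G.commute[of b "\<gamma>' k"] by simp
        thus "ip H k h = ip H k (\<gamma> b)" using eq[of k 0] by simp
      qed
      ultimately show ?thesis by (auto simp: u_eq g_def)
    qed
    show "ip G (\<tau> z\<^sub>0 x) y - ip G x (\<tau> z\<^sub>0 y) = (z\<^sub>0 - cnj z\<^sub>0) * ip K (g x) (g y)" for x y
    proof -
      have "ip G (\<gamma>' (\<gamma> x)) y = ip H (\<gamma> x) (\<gamma> y)"
        using adj[of y "\<gamma> x"] H.commute[of "\<gamma> y" "\<gamma> x"] G.commute[of y "\<gamma>' (\<gamma> x)"] by simp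
      thus ?thesis
        by (simp add: \<tau>\<^sub>0_eq G.form_simps C_sym g_def ip_K algebra_simps flip: adj)
    qed
  qed

  have "single_valued S"
  proof (rule single_valuedI)
    fix f f1 f2 assume "(f, f1) \<in> S" "(f, f2) \<in> S"
    from K.linear_relation_diff[OF K.linear_relation_rel_adjoint this]
    have "(0, f1 - f2) \<in> S" by simp
    hence "(0, f1 - f2) \<in> A" "g' (f1 - f2) = 0" by (simp_all add: S_iff)
    moreover obtain h a b where f: "f1 - f2 = (h, a, b)" by (cases "f1 - f2")
    ultimately have "(0, h) \<in> A\<^sub>0" "a = 0" "b = 0" "\<gamma>' h = 0"
      by (auto simp: A_def zero_prod_def g'_def)
    hence "f1 - f2 = 0"
      using minimal_multivalued_part[OF assms(7) G] by (simp add: f zero_prod_def \<gamma>'_def)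
    thus "f1 = f2" by simp
  qed
  moreover have "weyl_function_coincides K T \<Gamma>\<^sub>0 \<Gamma>\<^sub>1 \<tau> (\<O> \<union> cnj -` \<O>)"
    unfolding weyl_function_coincides_def kernel
  proof (intro conjI ballI ext)
    fix z x assume z: "z \<in> \<O> \<union> cnj -` \<O>"
    show "weyl_function K T \<Gamma>\<^sub>0 \<Gamma>\<^sub>1 z x = \<tau> z x"
      unfolding weyl_function[OF \<rho>[OF z]] g_def R[OF z] scl_K \<tau>_eq[OF z] \<tau>\<^sub>0_eq
      by (simp add: g'_def \<gamma>'_add \<gamma>'_scale G.scale_left_diff_distrib add.assoc)
  qed (use \<rho> in blast)
  ultimately show ?thesis
    using K symmetric_S K.closedin_rel_adjoint boundary_triple by blast
qed

end
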